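(* Let $\mathcal F_{\mathfrak h}$ be the free superfermion PVA over a field $\mathbb F$ of characteristic $0$ associated to a finite-dimensional superspace $\mathfrak h$ with a super-skewsymmetric nondegenerate bilinear form. Then: (a) Every Casimir element of the PVA $\mathcal F_{\mathfrak h}$ is a scalar multiple of $\int1$. (b) Every derivation of the PVA $\mathcal F_{\mathfrak h}$ is inner. (c) Any first-order deformation of $\mathcal F_{\mathfrak h}$ that preserves the product and the $\mathbb F[\partial]$-module structure is trivial.
   Context: $\mathbb F$ is a field of characteristic $0$. Superspaces are over $\mathbb F$ with parity $p$; formulas with signs are for parity-homogeneous elements. $\int:\mathcal V\to\mathcal V/\partial\mathcal V$ is the quotient map. PVA: a Poisson vertex superalgebra is a commutative (in the super sense) associative unital superalgebra $\mathcal V$ with an even derivation $\partial$ and a parity-preserving bilinear map $\mathcal V\otimes\mathcal V\to\mathcal V[\lambda]$, $a\otimes b\mapsto[a_\lambda b]$ ($\lambda$ even), with $[\partial a_\lambda b]=-\lambda[a_\lambda b]$, $[a_\lambda\partial b]=(\lambda+\partial)[a_\lambda b]$, $[a_\lambda b]=-(-1)^{p(a)p(b)}[b_{-\lambda-\partial}a]$ ($\partial$ acting from the left on coefficients), $[a_\lambda[b_\mu c]]-(-1)^{p(a)p(b)}[b_\mu[a_\lambda c]]=[[a_\lambda b]_{\lambda+\mu}c]$, and $[a_\lambda bc]=[a_\lambda b]c+(-1)^{p(b)p(c)}[a_\lambda c]b$. A Casimir element of $\mathcal V$ is $\int a\in\mathcal V/\partial\mathcal V$ with $[a_\lambda\mathcal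 V]|_{\lambda=0}=0$. A derivation of $\mathcal V$ is a linear map $D:\mathcal V\to\mathcal V$ commuting with $\partial$ which is a (super)derivation of the product and of the $\lambda$-bracket: $D[a_\lambda b]=[(Da)_\lambda b]+(-1)^{p(D)p(a)}[a_\lambda(Db)]$. It is inner if $D=[a_\lambda\,\cdot\,]|_{\lambda=0}$ for some $a\in\mathcal V$. A first-order deformation preserving the product and the $\mathbb F[\partial]$-module structure is a PVA structure over $\mathbb F[\epsilon]/(\epsilon^2)$ ($\epsilon$ even) on $\mathcal V\otimes\mathbb F[\epsilon]/(\epsilon^2)$ with product and $\partial$ extended $\epsilon$-linearly and $\lambda$-bracket $[a_\lambda b]+\epsilon\{a_\lambda b\}$, $a,b\in\mathcal V$. Two such are equivalent if related by an automorphism $\mathrm{id}+\epsilon D$, $D$ an even derivation of the product of $\mathcal V$ commuting with $\partial$; a deformation is trivial if it is equivalent to the one with $\{\cdot_\lambda\cdot\}=0$. Free superfermion PVA: $\mathfrak h$ is a finite-dimensional superspace with a nondegenerate bilinear form $(\cdot|\cdot)$ such that $(a|b)=-(-1)^{p(a)p(b)}(b|a)$ and $(a|b)=0$ if $p(a)\ne p(b)$. $\mathcal F_{\mathfrak h}=S(\mathbb F[\partial]\otimes\mathfrak h)$ (symmetric superalgebra), with $\partial$ extended as an even derivation and with the unique PVA $\lambda$-bracket such that $[a_\lambda b]=(a|b)1$ for $a,b\in\mathfrak h$. *)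

theory Defs
  imports "HOL-Computational_Algebra.Polynomial" "HOL-Library.Poly_Mapping" "HOL-Library.Z2"
begin

text \<open>Parities are elements of \<^typ>\<open>bit\<close> (the field with two elements), so that the sign
  $(-1)^{p(a)p(b)}$ is \<open>parity_sign (i * j)\<close> for \<open>a\<close> of parity \<open>i\<close> and \<open>b\<close> of parity \<open>j\<close>.\<close>

definition parity_sign :: "bit \<Rightarrow> 'r::ring_1" where
  "parity_sign i = (if i = 0 then 1 else - 1)"

text \<open>The ring of scalars is an arbitrary commutative ring because deformations are structures
  over the dual numbers.\<close>

locale superspace = module scale
  for scale :: "'k::comm_ring_1 \<Rightarrow> 'v::ab_group_add \<Rightarrow> 'v" +
  fixes V :: "bit \<Rightarrow> 'v set"
  assumes subspace_V: "subspace (V i)"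
    and V_inter: "V 0 \<inter> V 1 = {0}"
    and V_sum: "\<exists>x \<in> V 0. \<exists>y \<in> V 1. v = x + y"

locale comm_superalgebra = superspace scale V
  for scale :: "'k::comm_ring_1 \<Rightarrow> 'v::ring_1 \<Rightarrow> 'v" and V :: "bit \<Rightarrow> 'v set" +
  assumes scale_mult_left: "scale c x * y = scale c (x * y)"
    and scale_mult_right: "x * scale c y = scale c (x * y)"
    and one_even: "1 \<in> V 0"
    and mult_parity: "a \<in> V i \<Longrightarrow> b \<in> V j \<Longrightarrow> a * b \<in> V (i + j)"
    and supercomm: "a \<in> V i \<Longrightarrow> b \<in> V j \<Longrightarrow> a * b = parity_sign (i * j) * (b * a)"

definition product_derivation ::
  "('k::comm_ring_1 \<Rightarrow> 'v::ring_1 \<Rightarrow> 'v) \<Rightarrow> (bit \<Rightarrow> 'v set) \<Rightarrow> bit \<Rightarrow> ('v \<Rightarrow> 'v) \<Rightarrow> bool" where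
  "product_derivation scale V d D \<longleftrightarrow>
     module_hom scale scale D \<and>
     (\<forall>i. \<forall>a \<in> V i. D a \<in> V (i + d)) \<and>
     (\<forall>i. \<forall>a \<in> V i. \<forall>b. D (a * b) = D a * b + parity_sign (d * i) * (a * D b))"

text \<open>An element of $V[\lambda]$ is a polynomial \<open>p :: 'v poly\<close>: multiplication by $\lambda$ is
  \<open>pCons 0\<close>, and \<open>der\<close> acts on coefficients. \<open>lam_del\<close> is the operator $\lambda+\partial$, and
  \<open>subst_neg_lam_del der p\<close> is $p(-\lambda-\partial)$ with \<open>der\<close> acting from the left on coefficients,
  i.e. $\sum_n (-\lambda-\partial)^n p_n$.\<close>

definition lam_del :: "('v \<Rightarrow> 'v) \<Rightarrow> 'v::ab_group_add poly \<Rightarrow> 'v poly" where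
  "lam_del der p = pCons 0 p + map_poly der p"

definition subst_neg_lam_del :: "('v \<Rightarrow> 'v) \<Rightarrow> 'v::ab_group_add poly \<Rightarrow> 'v poly" where
  "subst_neg_lam_del der p = (\<Sum>n\<le>degree p. ((\<lambda>q. - lam_del der q) ^^ n) [:coeff p n:])"

text \<open>The Jacobi identity is the equality of the coefficients of $\lambda^m\mu^n$ in
  $[a_\lambda[b_\mu c]]-(-1)^{p(a)p(b)}[b_\mu[a_\lambda c]]=[[a_\lambda b]_{\lambda+\mu}c]$; on the
  right-hand side, if $[a_\lambda b]=\sum_k\lambda^k x_k$ and
  $[{x_k}_\lambda c]=\sum_l\lambda^l y_{k,l}$, one expands
  $\sum_{k,l}\lambda^k(\lambda+\mu)^l y_{k,l}$.\<close>

locale pva = comm_superalgebra scale V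
  for scale :: "'k::comm_ring_1 \<Rightarrow> 'v::ring_1 \<Rightarrow> 'v" and V :: "bit \<Rightarrow> 'v set" +
  fixes der :: "'v \<Rightarrow> 'v" and br :: "'v \<Rightarrow> 'v \<Rightarrow> 'v poly"
  assumes del_derivation: "product_derivation scale V 0 der"
    and br_linear_left: "module_hom scale (\<lambda>c. map_poly (scale c)) (\<lambda>a. br a b)"
    and br_linear_right: "module_hom scale (\<lambda>c. map_poly (scale c)) (br a)"
    and br_parity: "a \<in> V i \<Longrightarrow> b \<in> V j \<Longrightarrow> coeff (br a b) n \<in> V (i + j)"
    and br_del_left: "br (der a) b = - pCons 0 (br a b)"
    and br_del_right: "br a (der b) = lam_del der (br a b)"
    and br_skew: "a \<in> V i \<Longrightarrow> b \<in> V j \<Longrightarrow>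
      coeff (br a b) n = - (parity_sign (i * j) * coeff (subst_neg_lam_del der (br b a)) n)"
    and br_jacobi: "a \<in> V i \<Longrightarrow> b \<in> V j \<Longrightarrow>
      coeff (br a (coeff (br b c) n)) m
        - parity_sign (i * j) * coeff (br b (coeff (br a c) m)) n
      = (\<Sum>k\<le>m. of_nat ((m - k + n) choose n) * coeff (br (coeff (br a b) k) c) (m - k + n))"
    and br_leibniz: "b \<in> V i \<Longrightarrow> c \<in> V j \<Longrightarrow>
      coeff (br a (b * c)) n
      = coeff (br a b) n * c + parity_sign (i * j) * (coeff (br a c) n * b)"

text \<open>\<open>loc_fun der a\<close> is the class $\int a$ of \<open>a\<close> in $V/\partial V$, as a coset.\<close>

definition loc_fun :: "('v \<Rightarrow> 'v) \<Rightarrow> 'v::ab_group_add \<Rightarrow> 'v set" where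
  "loc_fun der a = {a + der b | b. True}"

definition casimir_elements ::
  "('v \<Rightarrow> 'v) \<Rightarrow> ('v \<Rightarrow> 'v \<Rightarrow> 'v poly) \<Rightarrow> 'v::ab_group_add set set" where
  "casimir_elements der br = {loc_fun der a | a. \<forall>b. coeff (br a b) 0 = 0}"

definition homogeneous_pva_derivation ::
  "('k::comm_ring_1 \<Rightarrow> 'v::ring_1 \<Rightarrow> 'v) \<Rightarrow> (bit \<Rightarrow> 'v set) \<Rightarrow> ('v \<Rightarrow> 'v) \<Rightarrow>
   ('v \<Rightarrow> 'v \<Rightarrow> 'v poly) \<Rightarrow> bit \<Rightarrow> ('v \<Rightarrow> 'v) \<Rightarrow> bool" where
  "homogeneous_pva_derivation scale V der br d D \<longleftrightarrow>
     product_derivation scale V d D \<and>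
     (\<forall>a. D (der a) = der (D a)) \<and>
     (\<forall>i. \<forall>a \<in> V i. \<forall>b n. D (coeff (br a b) n)
        = coeff (br (D a) b) n + parity_sign (d * i) * coeff (br a (D b)) n)"

text \<open>A derivation need not be homogeneous: it is the sum of an even and an odd one.\<close>

definition pva_derivation ::
  "('k::comm_ring_1 \<Rightarrow> 'v::ring_1 \<Rightarrow> 'v) \<Rightarrow> (bit \<Rightarrow> 'v set) \<Rightarrow> ('v \<Rightarrow> 'v) \<Rightarrow>
   ('v \<Rightarrow> 'v \<Rightarrow> 'v poly) \<Rightarrow> ('v \<Rightarrow> 'v) \<Rightarrow> bool" where
  "pva_derivation scale V der br D \<longleftrightarrow>
     (\<exists>D0 D1. homogeneous_pva_derivation scale V der br 0 D0 \<and>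
        homogeneous_pva_derivation scale V der br 1 D1 \<and> D = (\<lambda>x. D0 x + D1 x))"

definition inner_derivation :: "('v::zero \<Rightarrow> 'v \<Rightarrow> 'v poly) \<Rightarrow> ('v \<Rightarrow> 'v) \<Rightarrow> bool" where
  "inner_derivation br D \<longleftrightarrow> (\<exists>a. D = (\<lambda>b. coeff (br a b) 0))"

text \<open>\<open>Dual x y\<close> stands for $x+\epsilon y$ with $\epsilon^2=0$. Thus \<open>'f dual_num\<close> is
  $F[\epsilon]/(\epsilon^2)$ and \<open>'v dual_num\<close> is $V\otimes F[\epsilon]/(\epsilon^2)$.\<close>

datatype 'a dual_num = Dual (std_part: 'a) (eps_part: 'a)

instantiation dual_num :: (ab_group_add) ab_group_add
begin
definition "0 = Dual 0 0"
definition "x + y = Dual (std_part x + std_part y) (eps_part x + eps_part y)"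
definition "x - y = Dual (std_part x - std_part y) (eps_part x - eps_part y)"
definition "- x = Dual (- std_part x) (- eps_part x)"
instance
  by standard (simp_all add: zero_dual_num_def plus_dual_num_def minus_dual_num_def
      uminus_dual_num_def algebra_simps)
end

instantiation dual_num :: (ring_1) ring_1
begin
definition "1 = Dual 1 0"
definition "x * y =
  Dual (std_part x * std_part y) (std_part x * eps_part y + eps_part x * std_part y)"
instance
  by standard (simp_all add: zero_dual_num_def plus_dual_num_def one_dual_num_def
      times_dual_num_def algebra_simps)
end

instance dual_num :: (comm_ring_1) comm_ring_1
  by standard (simp_all add: plus_dual_num_def one_dual_num_def times_dual_num_def algebra_simps)

definition dual_scale ::
  "('k \<Rightarrow> 'v \<Rightarrow> 'v) \<Rightarrow> 'k dual_num \<Rightarrow> 'v::ab_group_add dual_num \<Rightarrow> 'v dual_num" where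
  "dual_scale scale c x = Dual (scale (std_part c) (std_part x))
     (scale (std_part c) (eps_part x) + scale (eps_part c) (std_part x))"

definition dual_parts :: "(bit \<Rightarrow> 'v set) \<Rightarrow> bit \<Rightarrow> 'v dual_num set" where
  "dual_parts V i = {Dual x y | x y. x \<in> V i \<and> y \<in> V i}"

text \<open>The extension of $a\otimes b\mapsto[a_\lambda b]+\epsilon\{a_\lambda b\}$ to $V\oplus\epsilon V$
  that is bilinear over the dual numbers.\<close>

definition dual_bracket ::
  "('v \<Rightarrow> 'v \<Rightarrow> 'v poly) \<Rightarrow> ('v \<Rightarrow> 'v \<Rightarrow> 'v poly) \<Rightarrow>
   'v::ab_group_add dual_num \<Rightarrow> 'v dual_num \<Rightarrow> 'v dual_num poly" where
  "dual_bracket br cbr x y =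
     map_poly (\<lambda>u. Dual u 0) (br (std_part x) (std_part y)) +
     map_poly (\<lambda>u. Dual 0 u) (br (eps_part x) (std_part y) + br (std_part x) (eps_part y)
        + cbr (std_part x) (std_part y))"

definition first_order_deformation ::
  "('k::comm_ring_1 \<Rightarrow> 'v::ring_1 \<Rightarrow> 'v) \<Rightarrow> (bit \<Rightarrow> 'v set) \<Rightarrow> ('v \<Rightarrow> 'v) \<Rightarrow>
   ('v \<Rightarrow> 'v \<Rightarrow> 'v poly) \<Rightarrow> ('v \<Rightarrow> 'v \<Rightarrow> 'v poly) \<Rightarrow> bool" where
  "first_order_deformation scale V der br cbr \<longleftrightarrow>
     pva (dual_scale scale) (dual_parts V) (map_dual_num der) (dual_bracket br cbr)"

text \<open>\<open>dual_exp D\<close> is the map $\mathrm{id}+\epsilon D$.\<close>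

definition dual_exp :: "('v \<Rightarrow> 'v) \<Rightarrow> 'v::ab_group_add dual_num \<Rightarrow> 'v dual_num" where
  "dual_exp D x = Dual (std_part x) (eps_part x + D (std_part x))"

definition equivalent_deformations ::
  "('k::comm_ring_1 \<Rightarrow> 'v::ring_1 \<Rightarrow> 'v) \<Rightarrow> (bit \<Rightarrow> 'v set) \<Rightarrow> ('v \<Rightarrow> 'v) \<Rightarrow>
   ('v \<Rightarrow> 'v \<Rightarrow> 'v poly) \<Rightarrow> ('v \<Rightarrow> 'v \<Rightarrow> 'v poly) \<Rightarrow> ('v \<Rightarrow> 'v \<Rightarrow> 'v poly) \<Rightarrow> bool" where
  "equivalent_deformations scale V der br cbr cbr' \<longleftrightarrow>
     (\<exists>D. product_derivation scale V 0 D \<and> (\<forall>a. D (der a) = der (D a)) \<and>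
        (\<forall>x y. map_poly (dual_exp D) (dual_bracket br cbr x y)
             = dual_bracket br cbr' (dual_exp D x) (dual_exp D y)))"

definition trivial_deformation ::
  "('k::comm_ring_1 \<Rightarrow> 'v::ring_1 \<Rightarrow> 'v) \<Rightarrow> (bit \<Rightarrow> 'v set) \<Rightarrow> ('v \<Rightarrow> 'v) \<Rightarrow>
   ('v \<Rightarrow> 'v \<Rightarrow> 'v poly) \<Rightarrow> ('v \<Rightarrow> 'v \<Rightarrow> 'v poly) \<Rightarrow> bool" where
  "trivial_deformation scale V der br cbr \<longleftrightarrow>
     equivalent_deformations scale V der br cbr (\<lambda>_ _. 0)"

text \<open>The free associative unital algebra on the set \<open>W\<close> consists of the finitely supported
  functions on words, and $S(W)$ is its quotient by the two-sided ideal generated by the relations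
  that make the letters linear (giving the tensor algebra $T(W)$) and by
  $a\otimes b-(-1)^{p(a)p(b)}b\otimes a$. That ideal is the linear span of the
  relations multiplied by words \<open>u\<close>, \<open>v\<close> on both sides.\<close>

definition sym_relations ::
  "('f::field \<Rightarrow> 'w::ab_group_add \<Rightarrow> 'w) \<Rightarrow> (bit \<Rightarrow> 'w set) \<Rightarrow> ('w list \<Rightarrow>\<^sub>0 'f) set" where
  "sym_relations scale W =
     {Poly_Mapping.single (u @ [a + b] @ v) 1 - Poly_Mapping.single (u @ [a] @ v) 1
        - Poly_Mapping.single (u @ [b] @ v) 1 | u v a b. True} \<union>
     {Poly_Mapping.single (u @ [scale c a] @ v) 1 - Poly_Mapping.single (u @ [a] @ v) c
        | u v c a. True} \<union>
     {Poly_Mapping.single (u @ [a, b] @ v) 1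
        - Poly_Mapping.single (u @ [b, a] @ v) (parity_sign (i * j))
        | u v a b i j. a \<in> W i \<and> b \<in> W j}"

definition sym_ideal ::
  "('f::field \<Rightarrow> 'w::ab_group_add \<Rightarrow> 'w) \<Rightarrow> (bit \<Rightarrow> 'w set) \<Rightarrow> ('w list \<Rightarrow>\<^sub>0 'f) set" where
  "sym_ideal scale W = module.span (\<lambda>c. Poly_Mapping.map ((*) c)) (sym_relations scale W)"

definition word_eval ::
  "('f::field \<Rightarrow> 'v::ring_1 \<Rightarrow> 'v) \<Rightarrow> ('w \<Rightarrow> 'v) \<Rightarrow> ('w list \<Rightarrow>\<^sub>0 'f) \<Rightarrow> 'v" where
  "word_eval scale \<iota> P =
     (\<Sum>xs \<in> Poly_Mapping.keys P. scale (Poly_Mapping.lookup P xs) (prod_list (map \<iota> xs)))"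

text \<open>The superalgebra \<open>V\<close> together with \<open>\<iota> : W \<rightarrow> V\<close> is (a copy of) $S(W)$: evaluation of words
  induces an isomorphism of the above quotient with \<open>V\<close>, and \<open>\<iota>\<close> preserves parity (which
  determines the grading of \<open>V\<close>).\<close>

definition is_symmetric_superalgebra ::
  "('f::field \<Rightarrow> 'w::ab_group_add \<Rightarrow> 'w) \<Rightarrow> (bit \<Rightarrow> 'w set) \<Rightarrow>
   ('f \<Rightarrow> 'v::ring_1 \<Rightarrow> 'v) \<Rightarrow> (bit \<Rightarrow> 'v set) \<Rightarrow> ('w \<Rightarrow> 'v) \<Rightarrow> bool" where
  "is_symmetric_superalgebra scaleW W scale V \<iota> \<longleftrightarrow>
     comm_superalgebra scale V \<and>
     (\<forall>i. \<iota> ` W i \<subseteq> V i) \<and>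
     surj (word_eval scale \<iota>) \<and>
     {P. word_eval scale \<iota> P = 0} = sym_ideal scaleW W"

locale skew_superspace = superspace scaleH H
  for scaleH :: "'f::field_char_0 \<Rightarrow> 'h::ab_group_add \<Rightarrow> 'h" and H :: "bit \<Rightarrow> 'h set" +
  fixes form :: "'h \<Rightarrow> 'h \<Rightarrow> 'f"
  assumes finite_dim: "\<exists>B. finite B \<and> span B = UNIV"
    and form_linear_left: "module_hom scaleH (*) (\<lambda>a. form a b)"
    and form_linear_right: "module_hom scaleH (*) (form a)"
    and form_skew: "a \<in> H i \<Longrightarrow> b \<in> H j \<Longrightarrow> form a b = - (parity_sign (i * j) * form b a)"
    and form_even: "a \<in> H i \<Longrightarrow> b \<in> H j \<Longrightarrow> i \<noteq> j \<Longrightarrow> form a b = 0"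
    and form_nondegenerate: "(\<And>b. form a b = 0) \<Longrightarrow> a = 0"

text \<open>$F[\partial]\otimes H$ is realised as \<open>'h poly\<close>: the polynomial with coefficients $h_n$ stands for
  $\sum_n\partial^n\otimes h_n$, and $\partial$ acts as \<open>pCons 0\<close>. The copy of \<open>a \<in> H\<close> is \<open>[:a:]\<close>.
  The PVA structure with the given values on generators is unique, so it is
  characterised by its axioms.\<close>

definition free_superfermion_pva ::
  "('f::field_char_0 \<Rightarrow> 'h::ab_group_add \<Rightarrow> 'h) \<Rightarrow> (bit \<Rightarrow> 'h set) \<Rightarrow> ('h \<Rightarrow> 'h \<Rightarrow> 'f) \<Rightarrow>
   ('f \<Rightarrow> 'v::ring_1 \<Rightarrow> 'v) \<Rightarrow> (bit \<Rightarrow> 'v set) \<Rightarrow> ('v \<Rightarrow> 'v) \<Rightarrow> ('v \<Rightarrow> 'v \<Rightarrow> 'v poly) \<Rightarrow>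
   ('h poly \<Rightarrow> 'v) \<Rightarrow> bool" where
  "free_superfermion_pva scaleH H form scale V der br \<iota> \<longleftrightarrow>
     is_symmetric_superalgebra (\<lambda>c. map_poly (scaleH c)) (\<lambda>i. {w. \<forall>n. coeff w n \<in> H i})
       scale V \<iota> \<and>
     (\<forall>w. der (\<iota> w) = \<iota> (pCons 0 w)) \<and>
     pva scale V der br \<and>
     (\<forall>a b. br (\<iota> [:a:]) (\<iota> [:b:]) = [:scale (form a b) 1:])"

end

theory Submission
  imports Defs
begin

text \<open>Fix a homogeneous basis $e_i$ of $H$ with dual basis $e^i$, $(e^i|e_j)=\delta_{ij}$. The
  coefficient of $\lambda^m$ in $[{e^i}_\lambda f]$ is the partial derivative
  $\partial f/\partial e_i^{(m)}$, so all vector fields can be written by means of the bracket; in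
  particular $Ef=\sum_{i,m}e_i^{(m)}[{e^i}_\lambda f]_m$ is the Euler operator, which multiplies a
  product of $d$ generators by $d$. Each part follows from a homotopy formula for $E$, because
  $\ker E=F1$, $V=F1+EV$, and $E+k$ is injective for $k\ge1$:

  (a) skewsymmetry gives $Ea\in\partial V$ for a Casimir element $\int a$;

  (b) for a derivation $D$ of parity $d$, the element $b=-\sum_i(-1)^{d\,p(e_i)}e_iD(e^i)$ satisfies
  $[b_\lambda c]|_{\lambda=0}=(E+1)Dc$ for $c\in H$, so $D=[a_\lambda\,\cdot\,]|_{\lambda=0}$ if
  $Ea=b$;

  (c) for a cocycle, $R(c)=\sum_{i,m}e_i^{(m)}\{{e^i}_\lambda c\}_m$ satisfies
  $[R(b)_\lambda c]+[b_\lambda R(c)]=(E+2)\{b_\lambda c\}$ for $b,c\in H$, and the deformation is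
  trivialised by the evolutionary vector field $D$ with $Dc=(E+1)^{-1}R(c)$.\<close>

subsection \<open>Substitution of $-\lambda-\partial$\<close>

text \<open>The bracket with \<open>e^i\<close> collects partial derivatives because brackets of
  generators do not involve \<lambda>, so that \<lambda>^m alone records the order of the derivative
  of a generator. The shifts 0, 1, 2 added to E in (a), (b), (c) count brackets with a generator:
  the factor \<open>e_i\<close> that stands in front of a contracted expression is itself hit by
  each such bracket, and by the expansion in dual bases every hit returns one copy of the
  expression.

  The delicate point is skewsymmetry of a contracted expression. It replaces \<lambda> by
  -\<lambda>-\<partial>, where \<partial> acts on whole coefficients and so also on the factor in
  front. Reversing the bracket therefore turns \<lambda> into \<lambda>+\<partial> with \<partial>
  acting on that factor only; this integration by parts is proved once and serves all three parts.

  Signs are kept under control by a Leibniz rule that does not mention the parity of the operator.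
  Sums, differences and commutators with even operators obey it again, so an operator identity has
  to be checked on generators only.\<close>

declare add_bit_eq_xor [simp del] mult_bit_eq_and [simp del]

lemma bit_cases: obtains "i = (0::bit)" | "i = 1"
  by (cases "i = 0") auto

lemma parity_sign_0 [simp]: "parity_sign 0 = 1"
  by (simp add: parity_sign_def)

lemma parity_sign_1 [simp]: "parity_sign 1 = - 1"
  by (simp add: parity_sign_def)

lemma parity_sign_add: "parity_sign (i + j) = parity_sign i * parity_sign j"
  by (cases i rule: bit_cases; cases j rule: bit_cases) simp_all

lemma parity_sign_square [simp]: "parity_sign i * (parity_sign i * x) = x"
  by (cases i rule: bit_cases) simp_all

lemma additive_parity_sign: "additive h \<Longrightarrow> h (parity_sign i * x) = parity_sign i * h x"
  by (cases i rule: bit_cases) (simp_all add: additive.minus)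

lemma additive_funpow:
  fixes d :: "'a::ab_group_add \<Rightarrow> 'a"
  assumes "additive d"
  shows "additive (d ^^ n)"
  by (induction n) (use assms in \<open>simp_all add: additive_def\<close>)

lemma coeff_map_poly_additive: "additive h \<Longrightarrow> coeff (map_poly h p) n = h (coeff p n)"
  by (simp add: coeff_map_poly additive.zero)

lemma additive_map_poly: "additive h \<Longrightarrow> additive (map_poly h)"
  by (simp add: additive_def poly_eq_iff coeff_map_poly_additive [unfolded additive_def])

lemma coeff_lam_del:
  "additive d \<Longrightarrow> coeff (lam_del d p) n = (if n = 0 then 0 else coeff p (n - 1)) + d (coeff p n)"
  by (cases n) (simp_all add: lam_del_def coeff_map_poly_additive)

lemma lam_del_0 [simp]: "lam_del d 0 = 0"
  by (simp add: lam_del_def)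

lemma additive_lam_del: "additive d \<Longrightarrow> additive (lam_del d)"
  by (simp add: additive_def lam_del_def additive_map_poly [unfolded additive_def])

lemma additive_neg_lam_del: "additive d \<Longrightarrow> additive (\<lambda>q. - lam_del d q)"
  using additive_lam_del [of d] by (simp add: additive_def)

text \<open>Terms above the degree vanish, so the sum may be padded to any bound; polynomials of
  different degrees can then share one range of summation.\<close>

lemma subst_neg_lam_del_eq_sum:
  assumes "degree p \<le> N"
  shows "subst_neg_lam_del d p = (\<Sum>n\<le>N. ((\<lambda>q. - lam_del d q) ^^ n) [:coeff p n:])"
proof -
  have zero: "((\<lambda>q. - lam_del d q) ^^ n) 0 = 0" for n
    by (induction n) simp_all
  show ?thesis
    unfolding subst_neg_lam_del_def
    by (rule sum.mono_neutral_left) (use assms in \<open>auto simp: zero coeff_eq_0\<close>)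
qed

lemma additive_subst_neg_lam_del:
  assumes d: "additive d"
  shows "additive (subst_neg_lam_del d)"
proof
  fix p q :: "'a poly"
  define N where "N = max (degree p) (degree q)"
  have N: "degree p \<le> N" "degree q \<le> N" "degree (p + q) \<le> N"
    by (auto simp: N_def intro: degree_add_le)
  show "subst_neg_lam_del d (p + q) = subst_neg_lam_del d p + subst_neg_lam_del d q"
    unfolding N [THEN subst_neg_lam_del_eq_sum]
    using additive_funpow [OF additive_neg_lam_del [OF d]]
    by (simp add: sum.distrib [symmetric] additive.add [symmetric])
qed

lemma subst_neg_lam_del_const [simp]: "subst_neg_lam_del d [:a:] = [:a:]"
  by (simp add: subst_neg_lam_del_def)

text \<open>Only iterates of -(\<lambda>+\<partial>) occur, so an additive map that intertwines the
  two derivations passes through. They may live on different types: the \<epsilon>-part of a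
  deformation is extracted this way.\<close>

lemma subst_neg_lam_del_natural:
  assumes "additive h" "additive d" "additive d'" and comm: "\<And>x. h (d x) = d' (h x)"
  shows "map_poly h (subst_neg_lam_del d p) = subst_neg_lam_del d' (map_poly h p)"
proof -
  have step: "map_poly h (lam_del d q) = lam_del d' (map_poly h q)" for q
    by (rule poly_eqI) (simp add: assms coeff_map_poly_additive coeff_lam_del additive.add additive.zero)
  have iter: "map_poly h (((\<lambda>q. - lam_del d q) ^^ n) q) = ((\<lambda>q. - lam_del d' q) ^^ n) (map_poly h q)" for n q
    by (induction n) (simp_all add: step additive.minus additive_map_poly assms(1))
  have deg: "degree (map_poly h p) \<le> degree p"
    by (rule map_poly_degree_leq)
  show ?thesis
    unfolding subst_neg_lam_del_eq_sum [OF order_refl [of "degree p"]] subst_neg_lam_del_eq_sum [OF deg]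
    by (simp add: additive.sum additive_map_poly assms(1) iter map_poly_pCons additive.zero
        coeff_map_poly_additive)
qed

text \<open>Every term of positive order has an outermost factor -(\<lambda>+\<partial>), whose
  value at \<lambda> = 0 is a total derivative. This produces the elements of \<partial>V in the
  treatment of Casimir elements.\<close>

lemma coeff_0_subst_neg_lam_del:
  assumes d: "additive d"
  obtains y where "coeff (subst_neg_lam_del d p) 0 = coeff p 0 + d y"
proof
  let ?q = "\<lambda>n. ((\<lambda>q. - lam_del d q) ^^ n) [:coeff p (Suc n):]"
  have "subst_neg_lam_del d p = [:coeff p 0:] + (\<Sum>n\<le>degree p. - lam_del d (?q n))"
    unfolding subst_neg_lam_del_eq_sum [OF le_SucI [OF order_refl [of "degree p"]]]
    by (subst sum.atMost_Suc_shift) simp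
  then show "coeff (subst_neg_lam_del d p) 0 = coeff p 0 + d (- (\<Sum>n\<le>degree p. coeff (?q n) 0))"
    by (simp add: coeff_sum coeff_lam_del d sum_negf additive.minus additive.sum)
qed

text \<open>\<open>taylor d x p\<close> lists the coefficients of $p(\lambda+\partial)x$, where $\partial$ acts on the
  factor \<open>x\<close> only.\<close>

definition taylor :: "('v \<Rightarrow> 'v) \<Rightarrow> 'v \<Rightarrow> 'v::ring_1 poly \<Rightarrow> nat \<Rightarrow> 'v" where
  "taylor d x p n = (\<Sum>l\<le>degree p. of_nat ((l + n) choose n) * ((d ^^ l) x * coeff p (l + n)))"

lemma taylor_eq_sum:
  assumes "degree p \<le> N"
  shows "taylor d x p n = (\<Sum>l\<le>N. of_nat ((l + n) choose n) * ((d ^^ l) x * coeff p (l + n)))"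
  unfolding taylor_def
  by (rule sum.mono_neutral_left) (use assms in \<open>auto simp: coeff_eq_0\<close>)

lemma additive_taylor: "additive (\<lambda>p. taylor d x p n)"
proof
  fix p q :: "'a poly"
  define N where "N = max (degree p) (degree q)"
  have N: "degree p \<le> N" "degree q \<le> N" "degree (p + q) \<le> N"
    by (auto simp: N_def intro: degree_add_le)
  show "taylor d x (p + q) n = taylor d x p n + taylor d x q n"
    unfolding N [THEN taylor_eq_sum] by (simp add: sum.distrib [symmetric] algebra_simps)
qed

lemma taylor_0: "degree p \<le> N \<Longrightarrow> taylor d x p 0 = (\<Sum>l\<le>N. (d ^^ l) x * coeff p l)"
  by (simp add: taylor_eq_sum)

lemma taylor_const: "taylor d x [:y:] n = (if n = 0 then x * y else 0)"
  by (cases n) (simp_all add: taylor_def)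

text \<open>An extra factor \<lambda> of p becomes \<lambda>+\<partial> with \<partial> acting on x:
  it either raises the power of \<lambda> or differentiates x. On coefficients this is Pascal's
  rule.\<close>

lemma taylor_pCons_0:
  "taylor d x (pCons 0 p) n = (if n = 0 then 0 else taylor d x p (n - 1)) + taylor d (d x) p n"
proof -
  let ?N = "degree p"
  have deg: "degree (pCons 0 p) \<le> Suc ?N"
    by (rule degree_pCons_le)
  show ?thesis
  proof (cases n)
    case 0
    have "taylor d x (pCons 0 p) 0 = (\<Sum>l\<le>Suc ?N. (d ^^ l) x * coeff (pCons 0 p) l)"
      by (rule taylor_0 [OF deg])
    also have "\<dots> = (\<Sum>l\<le>?N. (d ^^ l) (d x) * coeff p l)"
      by (subst sum.atMost_Suc_shift) (simp add: funpow_Suc_right del: funpow.simps)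
    finally show ?thesis
      using 0 by (simp add: taylor_0 [OF order_refl])
  next
    case (Suc m)
    let ?t = "\<lambda>l k. (d ^^ l) x * coeff p k"
    have "taylor d x (pCons 0 p) n = (\<Sum>l\<le>Suc ?N. of_nat ((l + Suc m) choose Suc m) * ?t l (l + m))"
      unfolding taylor_eq_sum [OF deg] Suc by simp
    also have "\<dots> = (\<Sum>l\<le>Suc ?N. of_nat ((l + m) choose m) * ?t l (l + m))
        + (\<Sum>l\<le>Suc ?N. of_nat ((l + m) choose Suc m) * ?t l (l + m))"
      by (simp only: sum.distrib [symmetric] distrib_right [symmetric] of_nat_add [symmetric]
          add_Suc_right binomial_Suc_Suc)
    also have "(\<Sum>l\<le>Suc ?N. of_nat ((l + m) choose m) * ?t l (l + m)) = taylor d x p m"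
      by (rule taylor_eq_sum [symmetric]) simp
    also have "(\<Sum>l\<le>Suc ?N. of_nat ((l + m) choose Suc m) * ?t l (l + m)) = taylor d (d x) p n"
      unfolding taylor_def Suc
      by (subst sum.atMost_Suc_shift) (simp add: binomial_eq_0 funpow_Suc_right del: funpow.simps)
    finally show ?thesis
      by (simp add: Suc)
  qed
qed

lemma taylor_map_poly:
  assumes d: "additive d" and mult: "\<And>x y. d (x * y) = d x * y + x * d y"
  shows "taylor d x (map_poly d p) n = d (taylor d x p n) - taylor d (d x) p n"
proof -
  have "d 1 = 0"
    using mult [of 1 1] by simp
  then have nat: "d (of_nat k) = 0" for k
    by (induction k) (simp_all add: additive.zero additive.add d)
  have "taylor d x (map_poly d p) n
      = (\<Sum>l\<le>degree p. of_nat ((l + n) choose n) * ((d ^^ l) x * d (coeff p (l + n))))"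
    by (simp add: taylor_eq_sum [OF map_poly_degree_leq] coeff_map_poly_additive d)
  also have "\<dots> = d (taylor d x p n) - taylor d (d x) p n"
    unfolding taylor_def
    by (simp add: additive.sum d nat mult distrib_left sum.distrib funpow_swap1)
  finally show ?thesis .
qed

text \<open>Multiplication by \<lambda> contributes \<lambda> plus the derivative of x, and
  \<partial> on coefficients contributes the derivative of the product minus that of x. The two
  corrections cancel, leaving \<lambda>+\<partial> on the whole product.\<close>

lemma taylor_lam_del:
  assumes d: "additive d" and mult: "\<And>x y. d (x * y) = d x * y + x * d y"
  shows "taylor d x (lam_del d p) n
    = (if n = 0 then 0 else taylor d x p (n - 1)) + d (taylor d x p n)"
  unfolding lam_del_def
  by (simp add: additive.add [OF additive_taylor] taylor_pCons_0 taylor_map_poly assms)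

text \<open>In $x\cdot p(-\lambda-\partial)$ the derivation acts on \<open>p\<close> alone; replacing $\lambda$ by
  $\lambda+\partial_x$ makes it act on the whole product.\<close>

lemma taylor_subst_neg_lam_del:
  assumes d: "additive d" and mult: "\<And>x y. d (x * y) = d x * y + x * d y"
  shows "taylor d x (subst_neg_lam_del d p) n
    = coeff (subst_neg_lam_del d (map_poly (\<lambda>y. x * y) p)) n"
proof -
  have iter: "taylor d x (((\<lambda>q. - lam_del d q) ^^ k) [:y:]) n
      = coeff (((\<lambda>q. - lam_del d q) ^^ k) [:x * y:]) n" for k y n
  proof (induction k arbitrary: n)
    case 0
    then show ?case
      by (cases n) (simp_all add: taylor_const)
  next
    case (Suc k)
    then show ?case
      by (simp add: additive.minus [OF additive_taylor] taylor_lam_del d mult coeff_lam_del)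
  qed
  show ?thesis
    unfolding subst_neg_lam_del_eq_sum [OF order_refl [of "degree p"]]
      subst_neg_lam_del_eq_sum [OF map_poly_degree_leq [of "\<lambda>y. x * y" p]]
    by (simp add: additive.sum [OF additive_taylor] iter coeff_sum coeff_map_poly)
qed

text \<open>The inner sum has the shape of the right-hand side of the Jacobi identity, here
  contracted with the derivatives of x. Putting m = k + l turns the triangle into a box, outside of
  which all terms vanish. Any large N is allowed, so that the same N can serve the other terms of
  the identity.\<close>

lemma sum_taylor_eq_convolution:
  fixes d :: "'v \<Rightarrow> 'v::ring_1"
  assumes zero: "\<And>k. k > K \<Longrightarrow> y k = 0"
  obtains N0 where "\<And>N. N \<ge> N0 \<Longrightarrow>
    (\<Sum>m\<le>N. (d ^^ m) x * (\<Sum>k\<le>m. of_nat ((m - k + n) choose n) * coeff (y k) (m - k + n)))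
      = (\<Sum>k\<le>K. taylor d ((d ^^ k) x) (y k) n)"
proof
  define M where "M = (\<Sum>k\<le>K. degree (y k))"
  define F where "F k l = (d ^^ (k + l)) x * (of_nat ((l + n) choose n) * coeff (y k) (l + n))" for k l
  have M: "degree (y k) \<le> M" if "k \<le> K" for k
    unfolding M_def using that by (intro member_le_sum) auto
  have F0: "F k l = 0" if "k > K \<or> l > M" for k l
    using that zero [of k] M [of k] by (cases "k > K") (auto simp: F_def coeff_eq_0)
  fix N
  assume N: "N \<ge> K + M"
  have "(\<Sum>m\<le>N. (d ^^ m) x * (\<Sum>k\<le>m. of_nat ((m - k + n) choose n) * coeff (y k) (m - k + n)))
      = (\<Sum>m\<le>N. \<Sum>k\<le>m. F k (m - k))"
    by (simp add: F_def sum_distrib_left)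
  also have "\<dots> = (\<Sum>(k, l)\<in>{(k, l). k + l \<le> N}. F k l)"
    by (rule sum.triangle_reindex_eq [symmetric])
  also have "\<dots> = (\<Sum>(k, l)\<in>{..K} \<times> {..M}. F k l)"
  proof (rule sum.mono_neutral_right)
    have "{(k, l). k + l \<le> N} \<subseteq> {..N} \<times> {..N}"
      by auto
    then show "finite {(k, l). k + l \<le> N}"
      by (rule finite_subset) simp
    show "{..K} \<times> {..M} \<subseteq> {(k, l). k + l \<le> N}"
      using N by auto
    show "\<forall>i\<in>{(k, l). k + l \<le> N} - {..K} \<times> {..M}. (case i of (k, l) \<Rightarrow> F k l) = 0"
      by auto (metis F0 not_le)+
  qed
  also have "\<dots> = (\<Sum>k\<le>K. \<Sum>l\<le>M. F k l)"
    by (rule sum.cartesian_product [symmetric])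
  also have "\<dots> = (\<Sum>k\<le>K. taylor d ((d ^^ k) x) (y k) n)"
  proof (rule sum.cong [OF refl])
    fix k
    assume "k \<in> {..K}"
    then have "degree (y k) \<le> M"
      using M by simp
    moreover have "F k l = of_nat ((l + n) choose n) * ((d ^^ l) ((d ^^ k) x) * coeff (y k) (l + n))" for l
    proof -
      have "(d ^^ (k + l)) x = (d ^^ l) ((d ^^ k) x)"
        by (simp add: add.commute [of k] funpow_add)
      then show ?thesis
        unfolding F_def by (metis mult.assoc mult_of_nat_commute)
    qed
    ultimately show "(\<Sum>l\<le>M. F k l) = taylor d ((d ^^ k) x) (y k) n"
      by (simp only: taylor_eq_sum)
  qed
  finally show "(\<Sum>m\<le>N. (d ^^ m) x * (\<Sum>k\<le>m. of_nat ((m - k + n) choose n) * coeff (y k) (m - k + n)))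
      = (\<Sum>k\<le>K. taylor d ((d ^^ k) x) (y k) n)" .
qed

subsection \<open>Derivations of commutative superalgebras\<close>

context superspace
begin

lemma V_add: "x \<in> V i \<Longrightarrow> y \<in> V i \<Longrightarrow> x + y \<in> V i"
  using subspace_V by (rule subspace_add)

lemma V_zero: "0 \<in> V i"
  using subspace_V by (rule subspace_0)

lemma V_neg: "x \<in> V i \<Longrightarrow> - x \<in> V i"
  using subspace_V by (rule subspace_neg)

lemma V_scale: "x \<in> V i \<Longrightarrow> scale c x \<in> V i"
  using subspace_V by (rule subspace_scale)

lemma V_sum_closed: "(\<And>k. k \<in> A \<Longrightarrow> f k \<in> V i) \<Longrightarrow> sum f A \<in> V i"
  using subspace_V by (rule subspace_sum)

lemma homogeneous_decomposition:
  obtains x y where "x \<in> V i" "y \<in> V (i + 1)" "v = x + y"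
proof -
  obtain x y where "x \<in> V 0" "y \<in> V 1" "v = x + y"
    using V_sum by blast
  then show thesis
    using that [of x y] that [of y x] by (cases i rule: bit_cases) (simp_all add: add.commute)
qed

lemma V_eq_0:
  assumes "x \<in> V i" "x \<in> V (i + 1)"
  shows "x = 0"
  using V_inter assms by (cases i rule: bit_cases) auto

lemma eq_0_if_homogeneous_parts_0:
  assumes "additive T" and "\<And>i x. x \<in> V i \<Longrightarrow> T x = 0"
  shows "T x = 0"
proof -
  obtain y z where "y \<in> V 0" "z \<in> V (0 + 1)" "x = y + z"
    by (rule homogeneous_decomposition)
  then show ?thesis
    using assms(2) [of y 0] assms(2) [of z "0 + 1"] by (simp add: additive.add [OF assms(1)])
qed

text \<open>The component of x of the wrong parity is mapped by T into both homogeneous parts, hence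
  to 0, and injectivity removes it. This shows that preimages under E + 1, and dual bases, keep
  parity.\<close>

lemma inverse_image_homogeneous:
  assumes "additive T" and inj: "\<And>y. T y = 0 \<Longrightarrow> y = 0" and even: "\<And>i x. x \<in> V i \<Longrightarrow> T x \<in> V i"
    and "T x \<in> V i"
  shows "x \<in> V i"
proof -
  obtain y z where yz: "y \<in> V i" "z \<in> V (i + 1)" "x = y + z"
    by (rule homogeneous_decomposition)
  have "T z = T x + - T y"
    using \<open>additive T\<close> by (simp add: yz(3) additive.add)
  moreover have "T x + - T y \<in> V i"
    by (intro V_add V_neg even yz assms)
  ultimately have "T z = 0"
    using even [OF yz(2)] by (intro V_eq_0 [of _ i]) simp_all
  then show ?thesis
    using inj [of z] yz by simp
qed

end

context comm_superalgebra
begin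

lemma V_parity_sign: "x \<in> V i \<Longrightarrow> parity_sign k * x \<in> V i"
  by (cases k rule: bit_cases) (simp_all add: V_neg)

lemma V_of_nat: "x \<in> V i \<Longrightarrow> of_nat k * x \<in> V i"
  by (induction k) (simp_all add: V_zero V_add distrib_right)

text \<open>Unlike the usual sign rule, this form of the Leibniz rule does not mention the parity of \<open>T\<close>.
  It is therefore preserved by left multiplication with arbitrary elements and by sums.\<close>

definition leibniz_map :: "('v \<Rightarrow> 'v) \<Rightarrow> bool" where
  "leibniz_map T \<longleftrightarrow> module_hom scale scale T \<and>
     (\<forall>i j. \<forall>a \<in> V i. \<forall>b \<in> V j. T (a * b) = T a * b + parity_sign (i * j) * (T b * a))"

lemma leibniz_mapI:
  assumes "\<And>x y. T (x + y) = T x + T y" "\<And>c x. T (scale c x) = scale c (T x)"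
    and "\<And>i j a b. a \<in> V i \<Longrightarrow> b \<in> V j \<Longrightarrow> T (a * b) = T a * b + parity_sign (i * j) * (T b * a)"
  shows "leibniz_map T"
  using assms by (auto simp: leibniz_map_def module_hom_iff module_axioms)

lemma
  assumes "leibniz_map T"
  shows leibniz_map_additive: "additive T"
    and leibniz_map_scale: "T (scale c x) = scale c (T x)"
    and leibniz_map_mult:
      "a \<in> V i \<Longrightarrow> b \<in> V j \<Longrightarrow> T (a * b) = T a * b + parity_sign (i * j) * (T b * a)"
  using assms by (auto simp: leibniz_map_def module_hom_iff additive_def)

lemma leibniz_map_one: "leibniz_map T \<Longrightarrow> T 1 = 0"
  using leibniz_map_mult [of T 1 0 1 0] one_even by simp

lemma leibniz_map_scalar: "leibniz_map T \<Longrightarrow> T (scale c 1) = 0"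
  by (simp add: leibniz_map_scale leibniz_map_one)

lemma leibniz_map_even:
  assumes T: "leibniz_map T" and even: "\<And>i a. a \<in> V i \<Longrightarrow> T a \<in> V i"
  shows "T (a * b) = T a * b + a * T b"
proof -
  note add = additive.add [OF leibniz_map_additive [OF T]]
  have hom: "T (a * b) = T a * b + a * T b" if "a \<in> V i" "b \<in> V j" for a b i j
    using leibniz_map_mult [OF T that] supercomm [OF that(1) even [OF that(2)]] by simp
  obtain x y where "x \<in> V 0" "y \<in> V (0 + 1)" "a = x + y"
    by (rule homogeneous_decomposition)
  moreover obtain z w where "z \<in> V 0" "w \<in> V (0 + 1)" "b = z + w"
    by (rule homogeneous_decomposition)
  ultimately show ?thesis
    by (simp add: add hom [of _ 0 _ 0] hom [of _ 0 _ 1] hom [of _ 1 _ 0] hom [of _ 1 _ 1] algebra_simps)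
qed

lemma leibniz_map_sum:
  assumes "\<And>e. e \<in> A \<Longrightarrow> leibniz_map (T e)"
  shows "leibniz_map (\<lambda>x. \<Sum>e\<in>A. T e x)"
proof (rule leibniz_mapI)
  show "(\<Sum>e\<in>A. T e (x + y)) = (\<Sum>e\<in>A. T e x) + (\<Sum>e\<in>A. T e y)" for x y
    using assms by (simp add: sum.distrib [symmetric] additive.add [OF leibniz_map_additive])
  show "(\<Sum>e\<in>A. T e (scale c x)) = scale c (\<Sum>e\<in>A. T e x)" for c x
    using assms by (simp add: scale_sum_right leibniz_map_scale)
  fix i j a b
  assume ab: "a \<in> V i" "b \<in> V j"
  show "(\<Sum>e\<in>A. T e (a * b)) = (\<Sum>e\<in>A. T e a) * b + parity_sign (i * j) * ((\<Sum>e\<in>A. T e b) * a)"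
    using leibniz_map_mult [OF assms ab]
    by (simp add: sum_distrib_left sum_distrib_right sum.distrib [symmetric])
qed

lemma leibniz_map_diff:
  assumes "leibniz_map S" "leibniz_map T"
  shows "leibniz_map (\<lambda>x. S x - T x)"
proof (rule leibniz_mapI)
  show "S (x + y) - T (x + y) = S x - T x + (S y - T y)" for x y
    by (simp add: assms [THEN leibniz_map_additive, THEN additive.add])
  show "S (scale c x) - T (scale c x) = scale c (S x - T x)" for c x
    by (simp add: assms [THEN leibniz_map_scale] scale_right_diff_distrib)
  fix i j a b
  assume ab: "a \<in> V i" "b \<in> V j"
  show "S (a * b) - T (a * b) = (S a - T a) * b + parity_sign (i * j) * ((S b - T b) * a)"
    by (simp add: leibniz_map_mult [OF assms(1) ab] leibniz_map_mult [OF assms(2) ab] algebra_simps)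
qed

lemma leibniz_map_add:
  assumes "leibniz_map S" "leibniz_map T"
  shows "leibniz_map (\<lambda>x. S x + T x)"
proof (rule leibniz_mapI)
  show "S (x + y) + T (x + y) = S x + T x + (S y + T y)" for x y
    by (simp add: assms [THEN leibniz_map_additive, THEN additive.add])
  show "S (scale c x) + T (scale c x) = scale c (S x + T x)" for c x
    by (simp add: assms [THEN leibniz_map_scale] scale_right_distrib)
  fix i j a b
  assume ab: "a \<in> V i" "b \<in> V j"
  show "S (a * b) + T (a * b) = (S a + T a) * b + parity_sign (i * j) * ((S b + T b) * a)"
    by (simp add: leibniz_map_mult [OF assms(1) ab] leibniz_map_mult [OF assms(2) ab] algebra_simps)
qed

text \<open>E satisfies the Leibniz rule without signs, so the mixed terms containing E of one
  factor and T of the other are the same in both orders and cancel.\<close>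

lemma leibniz_map_commutator:
  assumes E: "leibniz_map E" and even: "\<And>i a. a \<in> V i \<Longrightarrow> E a \<in> V i" and T: "leibniz_map T"
  shows "leibniz_map (\<lambda>x. E (T x) - T (E x))"
proof (rule leibniz_mapI)
  note addE = additive.add [OF leibniz_map_additive [OF E]]
  note addT = additive.add [OF leibniz_map_additive [OF T]]
  note signE = additive_parity_sign [OF leibniz_map_additive [OF E]]
  show "E (T (x + y)) - T (E (x + y)) = E (T x) - T (E x) + (E (T y) - T (E y))" for x y
    by (simp add: addE addT)
  show "E (T (scale c x)) - T (E (scale c x)) = scale c (E (T x) - T (E x))" for c x
    by (simp add: E T leibniz_map_scale scale_right_diff_distrib)
  fix i j a b
  assume ab: "a \<in> V i" "b \<in> V j"
  show "E (T (a * b)) - T (E (a * b))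
      = (E (T a) - T (E a)) * b + parity_sign (i * j) * ((E (T b) - T (E b)) * a)"
    by (simp add: leibniz_map_mult [OF T ab] leibniz_map_mult [OF T even [OF ab(1)] ab(2)]
        leibniz_map_mult [OF T ab(1) even [OF ab(2)]] addE addT signE leibniz_map_even [OF E even]
        algebra_simps)
qed

text \<open>Moving \<open>a\<close> past \<open>D b\<close> costs the sign of i(j + d), whose
  d-dependent part cancels the sign of the usual super Leibniz rule.\<close>

lemma product_derivation_leibniz_map:
  assumes D: "product_derivation scale V d D"
  shows "leibniz_map D"
proof (rule leibniz_mapI)
  have hom: "module_hom scale scale D"
    using D by (simp add: product_derivation_def)
  show "D (x + y) = D x + D y" "D (scale c x) = scale c (D x)" for x y c
    using hom by (simp_all add: module_hom_iff)
  fix i j a b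
  assume ab: "a \<in> V i" "b \<in> V j"
  have "D (a * b) = D a * b + parity_sign (d * i) * (a * D b)"
    using D ab by (simp add: product_derivation_def)
  also have "a * D b = parity_sign (i * (j + d)) * (D b * a)"
    using D ab by (intro supercomm) (auto simp: product_derivation_def)
  also have "parity_sign (d * i) * (parity_sign (i * (j + d)) * (D b * a)) = parity_sign (i * j) * (D b * a)"
    by (cases i rule: bit_cases; cases j rule: bit_cases; cases d rule: bit_cases) simp_all
  finally show "D (a * b) = D a * b + parity_sign (i * j) * (D b * a)" .
qed

lemma leibniz_map_product_derivation:
  assumes T: "leibniz_map T" and even: "\<And>i a. a \<in> V i \<Longrightarrow> T a \<in> V i"
  shows "product_derivation scale V 0 T"
  using T even leibniz_map_even [OF T even] by (simp add: product_derivation_def leibniz_map_def)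

end

section \<open>Sign and skewsymmetry calculus of the \<lambda>-bracket\<close>

context pva
begin

abbreviation flip :: "'v poly \<Rightarrow> 'v poly" where
  "flip \<equiv> subst_neg_lam_del der"

lemma leibniz_map_der: "leibniz_map der"
  using del_derivation by (rule product_derivation_leibniz_map)

lemmas additive_der = leibniz_map_additive [OF leibniz_map_der]

lemma der_even: "a \<in> V i \<Longrightarrow> der a \<in> V i"
  using del_derivation by (auto simp: product_derivation_def)

lemma der_pow_even: "a \<in> V i \<Longrightarrow> (der ^^ n) a \<in> V i"
  by (induction n) (simp_all add: der_even)

lemma der_mult: "der (x * y) = der x * y + x * der y"
  by (rule leibniz_map_even [OF leibniz_map_der der_even])

lemma additive_br_right: "additive (br a)"
  using br_linear_right by (auto simp: module_hom_iff additive_def)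

lemma additive_br_left: "additive (\<lambda>a. br a b)"
  using br_linear_left by (auto simp: module_hom_iff additive_def)

lemma coeff_br_scale_right: "coeff (br a (scale c b)) n = scale c (coeff (br a b) n)"
  using br_linear_right by (simp add: module_hom_iff coeff_map_poly)

lemma coeff_br_scale_left: "coeff (br (scale c a) b) n = scale c (coeff (br a b) n)"
  using br_linear_left by (simp add: module_hom_iff coeff_map_poly)

lemma leibniz_map_br: "leibniz_map (\<lambda>b. coeff (br a b) n)"
  by (rule leibniz_mapI)
    (simp_all add: additive.add [OF additive_br_right] coeff_br_scale_right, rule br_leibniz)

lemma br_parity_sign_right: "br a (parity_sign i * b) = map_poly (\<lambda>x. parity_sign i * x) (br a b)"
  by (cases i rule: bit_cases)
    (simp_all add: poly_eq_iff coeff_map_poly additive.minus [OF additive_br_right])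

lemma br_scalar_right: "br a (scale c 1) = 0"
  by (simp add: poly_eq_iff leibniz_map_scalar [OF leibniz_map_br])

lemma additive_flip: "additive flip"
  using additive_der by (rule additive_subst_neg_lam_del)

lemma flip_parity_sign: "flip (map_poly (\<lambda>x. parity_sign i * x) p) = map_poly (\<lambda>x. parity_sign i * x) (flip p)"
  by (rule subst_neg_lam_del_natural [symmetric])
    (simp_all add: additive_der additive_parity_sign [OF additive_der] additive.intro distrib_left)

lemma flip_scale: "coeff (flip (map_poly (scale c) p)) n = scale c (coeff (flip p) n)"
proof -
  have "map_poly (scale c) (flip p) = flip (map_poly (scale c) p)"
    by (rule subst_neg_lam_del_natural)
      (simp_all add: additive_der additive.intro scale_right_distrib leibniz_map_scale [OF leibniz_map_der])
  then show ?thesis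
    by (metis coeff_map_poly scale_zero_right)
qed

lemma br_skew_poly:
  "a \<in> V i \<Longrightarrow> b \<in> V j \<Longrightarrow> br a b = - map_poly (\<lambda>x. parity_sign (i * j) * x) (flip (br b a))"
  by (rule poly_eqI) (simp add: coeff_map_poly br_skew [of a i b j])

lemma flip_br:
  assumes "a \<in> V i" "b \<in> V j"
  shows "flip (br a b) = - map_poly (\<lambda>x. parity_sign (i * j) * x) (br b a)"
  by (rule poly_eqI)
    (simp add: br_skew_poly [OF assms(2,1)] coeff_map_poly mult.commute [of j i])

lemma br_scalar_left: "br (scale c 1) b = 0"
proof (rule eq_0_if_homogeneous_parts_0 [where T = "br (scale c 1)"])
  fix i x
  assume x: "x \<in> V i"
  show "br (scale c 1) x = 0"
    using br_skew_poly [OF V_scale [OF one_even] x]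
    by (simp add: br_scalar_right additive.zero [OF additive_flip])
qed (rule additive_br_right)

lemma br_mult_homogeneous:
  assumes "a \<in> V i" "b \<in> V j" "c \<in> V k"
  shows "coeff (br a (b * c)) n = coeff (br a b) n * c + parity_sign (i * j) * (b * coeff (br a c) n)"
proof -
  have "parity_sign (j * k) * (coeff (br a c) n * b)
      = parity_sign (j * k) * (parity_sign (j * (i + k)) * (b * coeff (br a c) n))"
    using supercomm [OF assms(2) br_parity [OF assms(1,3)]] by simp
  also have "\<dots> = parity_sign (i * j) * (b * coeff (br a c) n)"
    by (cases i rule: bit_cases; cases j rule: bit_cases; cases k rule: bit_cases) simp_all
  finally show ?thesis
    using br_leibniz [OF assms(2,3)] by simp
qed

lemma taylor_parity_sign:
  "taylor der g (map_poly (\<lambda>x. parity_sign i * x) p) n = parity_sign i * taylor der g p n"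
proof -
  have "map_poly (\<lambda>x. - x) p = - p"
    by (simp add: poly_eq_iff coeff_map_poly)
  then show ?thesis
    by (cases i rule: bit_cases) (simp_all add: additive.minus [OF additive_taylor])
qed

text \<open>This is the integration by parts behind all three homotopy formulas: reversing the
  bracket by skewsymmetry undoes the substitution of -\<lambda>-\<partial>, except that \<partial>
  still acts on the prefactor g.\<close>

lemma coeff_flip_mult_br:
  assumes "c \<in> V k" "y \<in> V j"
  shows "coeff (flip (map_poly (\<lambda>z. g * z) (br c y))) n = - (parity_sign (k * j) * taylor der g (br y c) n)"
proof -
  have "coeff (flip (map_poly (\<lambda>z. g * z) (br c y))) n = taylor der g (flip (br c y)) n"
    by (rule taylor_subst_neg_lam_del [symmetric]) (simp_all add: additive_der der_mult)
  also have "\<dots> = - (parity_sign (k * j) * taylor der g (br y c) n)"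
    by (simp only: flip_br [OF assms] additive.minus [OF additive_taylor] taylor_parity_sign)
  finally show ?thesis .
qed

lemma taylor_parity:
  assumes "x \<in> V i" "\<And>m. coeff p m \<in> V j"
  shows "taylor der x p n \<in> V (i + j)"
  unfolding taylor_def using assms by (intro V_sum_closed V_of_nat mult_parity der_pow_even) simp_all

end

subsection \<open>Evolutionary vector fields and the Euler operator\<close>

text \<open>\<open>gen\<close> is a homogeneous basis of the generating space and \<open>dual\<close> its left dual basis, both
  viewed inside the algebra.\<close>

locale superfermion = pva scale V der br
  for scale :: "'f::field_char_0 \<Rightarrow> 'v::ring_1 \<Rightarrow> 'v" and V der br +
  fixes B :: "'b set" and gen dual :: "'b \<Rightarrow> 'v" and par :: "'b \<Rightarrow> bit" and gram :: "'b \<Rightarrow> 'b \<Rightarrow> 'f"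
  assumes finite_B: "finite B"
    and gen_par: "e \<in> B \<Longrightarrow> gen e \<in> V (par e)"
    and dual_par: "e \<in> B \<Longrightarrow> dual e \<in> V (par e)"
    and br_dual_gen: "e \<in> B \<Longrightarrow> e' \<in> B \<Longrightarrow> br (dual e) (gen e') = [:if e = e' then 1 else 0:]"
    and gen_eq_sum_dual: "e \<in> B \<Longrightarrow> gen e = (\<Sum>e'\<in>B. scale (gram e e') (dual e'))"
    and gram_even: "e \<in> B \<Longrightarrow> e' \<in> B \<Longrightarrow> par e \<noteq> par e' \<Longrightarrow> gram e e' = 0"
    and generated:
      "span {prod_list (map (\<lambda>(e, n). (der ^^ n) (gen e)) w) | w. fst ` set w \<subseteq> B} = UNIV"
begin

definition word :: "('b \<times> nat) list \<Rightarrow> 'v" where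
  "word w = prod_list (map (\<lambda>(e, n). (der ^^ n) (gen e)) w)"

definition words :: "nat \<Rightarrow> 'v set" where
  "words k = {word w | w. fst ` set w \<subseteq> B \<and> k \<le> length w}"

lemma word_Nil [simp]: "word [] = 1"
  by (simp add: word_def)

lemma word_Cons [simp]: "word ((e, n) # w) = (der ^^ n) (gen e) * word w"
  by (simp add: word_def)

lemma span_words: "span (words 0) = UNIV"
  using generated by (simp add: words_def word_def)

lemma words_in_span: "x \<in> span (words 0)"
  by (simp add: span_words)

lemma word_homogeneous: "fst ` set w \<subseteq> B \<Longrightarrow> \<exists>i. word w \<in> V i"
proof (induction w)
  case Nil
  then show ?case
    using one_even by auto
next
  case (Cons a w)
  obtain e n where a: "a = (e, n)"
    by (cases a)
  obtain i where "word w \<in> V i"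
    using Cons by auto
  then have "word (a # w) \<in> V (par e + i)"
    using Cons.prems by (auto simp: a intro!: mult_parity der_pow_even gen_par)
  then show ?case ..
qed

text \<open>Uniqueness of derivations with prescribed values on the generators and their
  derivatives, in the form applied to differences of operators.\<close>

lemma leibniz_map_eq_0:
  assumes T: "leibniz_map T" and gen: "\<And>e n. e \<in> B \<Longrightarrow> T ((der ^^ n) (gen e)) = 0"
  shows "T x = 0"
proof -
  note add = additive.add [OF leibniz_map_additive [OF T]]
    and zero = additive.zero [OF leibniz_map_additive [OF T]]
  have word: "T (word w) = 0" if "fst ` set w \<subseteq> B" for w
    using that
  proof (induction w)
    case Nil
    then show ?case
      by (simp add: leibniz_map_one [OF T])
  next
    case (Cons a w)
    obtain e n where a: "a = (e, n)" and e: "e \<in> B"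
      using Cons.prems by (cases a) auto
    obtain i where i: "word w \<in> V i"
      using word_homogeneous [of w] Cons.prems by auto
    show ?case
      using leibniz_map_mult [OF T der_pow_even [OF gen_par [OF e], of n] i] gen [OF e, of n] Cons
      by (simp add: a)
  qed
  show ?thesis
    using words_in_span [of x]
    by (induction rule: span_induct_alt)
      (auto simp: add zero leibniz_map_scale [OF T] words_def word)
qed

lemma leibniz_map_eq_0_commuting:
  assumes T: "leibniz_map T" and der: "\<And>x. T (der x) = der (T x)"
    and gen: "\<And>e. e \<in> B \<Longrightarrow> T (gen e) = 0"
  shows "T x = 0"
proof (rule leibniz_map_eq_0 [OF T])
  fix e n
  assume "e \<in> B"
  then show "T ((der ^^ n) (gen e)) = 0"
    by (induction n) (simp_all add: gen der additive.zero [OF additive_der])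
qed

text \<open>The evolutionary vector field with characteristic \<open>P\<close>, since the coefficient of $\lambda^m$ in
  the bracket with \<open>dual e\<close> is the partial derivative with respect to $\partial^m$ \<open>(gen e)\<close>.\<close>

definition vf :: "('b \<Rightarrow> 'v) \<Rightarrow> 'v \<Rightarrow> 'v" where
  "vf P x = (\<Sum>e\<in>B. taylor der (P e) (br (dual e) x) 0)"

lemma leibniz_map_taylor_br: "leibniz_map (\<lambda>x. taylor der y (br a x) 0)"
proof (rule leibniz_mapI)
  show "taylor der y (br a (x + z)) 0 = taylor der y (br a x) 0 + taylor der y (br a z) 0" for x z
    by (simp add: additive.add [OF additive_br_right] additive.add [OF additive_taylor])
  show "taylor der y (br a (scale c x)) 0 = scale c (taylor der y (br a x) 0)" for c x
  proof -
    define N where "N = max (degree (br a (scale c x))) (degree (br a x))"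
    have N: "degree (br a (scale c x)) \<le> N" "degree (br a x) \<le> N"
      by (auto simp: N_def)
    show ?thesis
      unfolding N [THEN taylor_0]
      by (simp add: coeff_br_scale_right scale_mult_right scale_sum_right)
  qed
  fix i j u v
  assume uv: "u \<in> V i" "v \<in> V j"
  define N where "N = max (degree (br a (u * v))) (max (degree (br a u)) (degree (br a v)))"
  have N: "degree (br a (u * v)) \<le> N" "degree (br a u) \<le> N" "degree (br a v) \<le> N"
    by (auto simp: N_def)
  show "taylor der y (br a (u * v)) 0
      = taylor der y (br a u) 0 * v + parity_sign (i * j) * (taylor der y (br a v) 0 * u)"
    unfolding N [THEN taylor_0] br_leibniz [OF uv]
    by (cases i rule: bit_cases; cases j rule: bit_cases)
      (simp_all add: sum_distrib_right sum.distrib [symmetric] sum_negf [symmetric] algebra_simps)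
qed

lemma leibniz_map_vf: "leibniz_map (vf P)"
  unfolding vf_def by (intro leibniz_map_sum leibniz_map_taylor_br)

text \<open>The operator \<lambda>+\<partial> from right sesquilinearity turns, after contraction
  with the derivatives of the characteristic and at \<lambda> = 0, into \<partial> of the whole
  product.\<close>

lemma vf_der: "vf P (der x) = der (vf P x)"
  by (simp add: vf_def br_del_right taylor_lam_del additive_der der_mult additive.sum [OF additive_der])

lemma vf_der_pow: "vf P ((der ^^ n) x) = (der ^^ n) (vf P x)"
  by (induction n) (simp_all add: vf_der)

lemma vf_gen:
  assumes e: "e \<in> B"
  shows "vf P (gen e) = P e"
proof -
  have "vf P (gen e) = (\<Sum>e'\<in>B. if e' = e then P e' else 0)"
    unfolding vf_def by (rule sum.cong [OF refl]) (simp only: br_dual_gen e taylor_const, simp)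
  then show ?thesis
    using finite_B e by simp
qed

lemma vf_even:
  assumes "\<And>e. e \<in> B \<Longrightarrow> P e \<in> V (par e)" "x \<in> V i"
  shows "vf P x \<in> V i"
  unfolding vf_def
proof (rule V_sum_closed)
  fix e
  assume e: "e \<in> B"
  have "taylor der (P e) (br (dual e) x) 0 \<in> V (par e + (par e + i))"
    by (intro taylor_parity br_parity dual_par assms e)
  then show "taylor der (P e) (br (dual e) x) 0 \<in> V i"
    by (cases "par e" rule: bit_cases) (simp_all add: add.assoc [symmetric])
qed

section \<open>The Euler operator: eigenvalues, kernel and range\<close>

definition euler :: "'v \<Rightarrow> 'v" where
  "euler = vf gen"

lemma leibniz_map_euler: "leibniz_map euler"
  unfolding euler_def by (rule leibniz_map_vf)

lemmas additive_euler = leibniz_map_additive [OF leibniz_map_euler]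

lemma euler_even: "x \<in> V i \<Longrightarrow> euler x \<in> V i"
  unfolding euler_def by (rule vf_even [OF gen_par])

lemma euler_mult: "euler (x * y) = euler x * y + x * euler y"
  by (rule leibniz_map_even [OF leibniz_map_euler euler_even])

lemma euler_der: "euler (der x) = der (euler x)"
  unfolding euler_def by (rule vf_der)

lemma euler_der_gen: "e \<in> B \<Longrightarrow> euler ((der ^^ n) (gen e)) = (der ^^ n) (gen e)"
  unfolding euler_def by (simp add: vf_der_pow vf_gen)

lemma euler_word: "fst ` set w \<subseteq> B \<Longrightarrow> euler (word w) = scale (of_nat (length w)) (word w)"
proof (induction w)
  case Nil
  then show ?case
    by (simp add: leibniz_map_one [OF leibniz_map_euler])
next
  case (Cons a w)
  then show ?case
    by (cases a) (simp add: euler_mult euler_der_gen scale_mult_right scale_left_distrib)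
qed

text \<open>This operator kills combinations of words with lengths in \<open>ds\<close>, but acts as a nonzero
  scalar on eigenvectors of $E$ with an eigenvalue outside \<open>ds\<close>.\<close>

definition euler_ann :: "nat list \<Rightarrow> 'v \<Rightarrow> 'v" where
  "euler_ann ds = fold (\<lambda>d y. euler y - scale (of_nat d) y) ds"

lemma additive_euler_ann: "additive (euler_ann ds)"
proof
  show "euler_ann ds (x + y) = euler_ann ds x + euler_ann ds y" for x y
    by (induction ds arbitrary: x y)
      (simp_all add: euler_ann_def additive.add [OF additive_euler] scale_right_distrib
        add_diff_add)
qed

lemma euler_ann_eigenvector:
  assumes "euler x = scale c x"
  shows "euler_ann ds x = scale (\<Prod>d\<leftarrow>ds. c - of_nat d) x"
proof -
  have step: "euler (scale b x) - scale (of_nat d) (scale b x) = scale (b * (c - of_nat d)) x" for b d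
    by (simp add: leibniz_map_scale [OF leibniz_map_euler] assms right_diff_distrib
        scale_left_diff_distrib mult.commute)
  have "euler_ann ds (scale b x) = scale (b * (\<Prod>d\<leftarrow>ds. c - of_nat d)) x" for b
  proof (induction ds arbitrary: b)
    case (Cons d ds)
    then show ?case
      by (simp only: euler_ann_def fold_Cons o_apply step list.map prod_list.Cons mult.assoc)
  qed (simp add: euler_ann_def)
  from this [of 1] show ?thesis
    by simp
qed

text \<open>A combination involves finitely many words; once M exceeds all their lengths, each word
  is killed by the factor belonging to its own length.\<close>

lemma euler_ann_words:
  assumes "x \<in> span (words k)"
  shows "\<exists>N. \<forall>M\<ge>N. euler_ann [k..<M] x = 0"
  using assms
proof (induction rule: span_induct_alt)
  case base
  then show ?case
    by (simp add: additive.zero [OF additive_euler_ann])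
next
  case (step c x y)
  obtain N where N: "\<And>M. M \<ge> N \<Longrightarrow> euler_ann [k..<M] y = 0"
    using step.IH by blast
  obtain w where w: "x = word w" "fst ` set w \<subseteq> B" "k \<le> length w"
    using step.hyps by (auto simp: words_def)
  have "euler_ann [k..<M] (scale c x) = 0" if "M > length w" for M
  proof -
    have "euler (scale c x) = scale (of_nat (length w)) (scale c x)"
      by (simp add: w euler_word leibniz_map_scale [OF leibniz_map_euler] mult.commute)
    moreover have "(\<Prod>d\<leftarrow>[k..<M]. of_nat (length w) - of_nat d :: 'f) = 0"
      using w that by (auto simp: prod_list_zero_iff)
    ultimately show ?thesis
      by (simp add: euler_ann_eigenvector)
  qed
  then show ?case
    using N by (intro exI [of _ "max N (Suc (length w))"])
      (simp add: additive.add [OF additive_euler_ann])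
qed

text \<open>The annihilator kills x as a combination of words, yet multiplies the eigenvector x by a
  product of nonzero scalars. Only a spanning family of words enters this argument.\<close>

lemma euler_eigenvalue:
  assumes "x \<in> span (words k)" "euler x = scale c x" "\<And>d. d \<ge> k \<Longrightarrow> c \<noteq> of_nat d"
  shows "x = 0"
proof -
  obtain N where "euler_ann [k..<N] x = 0"
    using euler_ann_words [OF assms(1)] by blast
  then have *: "scale (\<Prod>d\<leftarrow>[k..<N]. c - of_nat d) x = 0"
    by (simp add: euler_ann_eigenvector [OF assms(2)])
  have "(\<Prod>d\<leftarrow>[k..<N]. c - of_nat d) \<noteq> 0"
    using assms(3) by (fastforce simp: prod_list_zero_iff)
  then have "scale (inverse (\<Prod>d\<leftarrow>[k..<N]. c - of_nat d) * (\<Prod>d\<leftarrow>[k..<N]. c - of_nat d)) x = x"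
    by simp
  then show ?thesis
    by (metis * scale_scale scale_zero_right)
qed

text \<open>In characteristic 0 the eigenvalue -(k + 1) is never the length of a word.\<close>

lemma euler_plus_eq_0:
  assumes "euler x + scale (of_nat (Suc k)) x = 0"
  shows "x = 0"
proof (rule euler_eigenvalue [OF words_in_span])
  show "euler x = scale (- of_nat (Suc k)) x"
    using assms by (simp only: scale_minus_left eq_neg_iff_add_eq_0)
  show "- of_nat (Suc k) \<noteq> (of_nat d :: 'f)" for d
  proof
    assume "- of_nat (Suc k) = (of_nat d :: 'f)"
    then have "(of_nat (d + Suc k) :: 'f) = 0"
      by (simp only: of_nat_add) (metis add.left_inverse)
    then show False
      unfolding of_nat_eq_0_iff by simp
  qed
qed

lemma scalar_plus_words: "\<exists>c. \<exists>y \<in> span (words 1). x = scale c 1 + y"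
  using words_in_span [of x]
proof (induction rule: span_induct_alt)
  case base
  then show ?case
    by (intro exI [of _ 0] bexI [of _ 0]) (simp_all add: span_zero)
next
  case (step c x y)
  obtain b z where y: "y = scale b 1 + z" "z \<in> span (words 1)"
    using step.IH by blast
  obtain w where w: "x = word w" "fst ` set w \<subseteq> B"
    using step.hyps by (auto simp: words_def)
  show ?case
  proof (cases w)
    case Nil
    then show ?thesis
      using w y by (intro exI [of _ "c + b"] bexI [of _ z]) (simp_all add: scale_left_distrib add.assoc)
  next
    case (Cons a v)
    then have "x \<in> words 1"
      unfolding words_def using w by (intro CollectI exI [of _ w]) simp
    then show ?thesis
      using y by (intro exI [of _ b] bexI [of _ "scale c x + z"])
        (simp_all add: span_add span_scale span_base add.left_commute)
  qed
qed

lemma words_subset_range_euler: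
  assumes "y \<in> span (words 1)"
  shows "\<exists>z. y = euler z"
  using assms
proof (induction rule: span_induct_alt)
  case base
  then show ?case
    by (metis additive.zero [OF additive_euler])
next
  case (step c x y)
  obtain z where z: "y = euler z"
    using step.IH by blast
  obtain w where w: "x = word w" "fst ` set w \<subseteq> B" "1 \<le> length w"
    using step.hyps by (auto simp: words_def)
  have "scale c x = euler (scale (c / of_nat (length w)) x)"
    using w(3) by (cases "w = []") (auto simp: w(1) leibniz_map_scale [OF leibniz_map_euler] euler_word [OF w(2)])
  then show ?case
    by (metis z additive.add [OF additive_euler])
qed

lemma euler_eq_0_imp_scalar:
  assumes "euler x = 0"
  shows "\<exists>c. x = scale c 1"
proof -
  obtain c y where y: "y \<in> span (words 1)" "x = scale c 1 + y"
    using scalar_plus_words by blast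
  have "euler y = scale 0 y"
    using assms by (simp add: y(2) additive.add [OF additive_euler] leibniz_map_scalar [OF leibniz_map_euler])
  then have "y = 0"
    by (rule euler_eigenvalue [OF y(1)]) simp
  then show ?thesis
    using y by auto
qed

lemma euler_plus_one_surj: "\<exists>y. x = euler y + y"
  using words_in_span [of x]
proof (induction rule: span_induct_alt)
  case base
  then show ?case
    by (intro exI [of _ 0]) (simp add: additive.zero [OF additive_euler])
next
  case (step c x y)
  obtain z where z: "y = euler z + z"
    using step.IH by blast
  obtain w where w: "x = word w" "fst ` set w \<subseteq> B"
    using step.hyps by (auto simp: words_def)
  let ?b = "c / of_nat (Suc (length w))"
  have "scale c x = scale (?b * of_nat (length w) + ?b) x"
  proof -
    have "?b * of_nat (length w) + ?b = ?b * of_nat (Suc (length w))"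
      by (simp add: distrib_left)
    then show ?thesis
      by (simp del: of_nat_Suc)
  qed
  also have "\<dots> = euler (scale ?b x) + scale ?b x"
    by (simp add: w(1) leibniz_map_scale [OF leibniz_map_euler] euler_word [OF w(2)] scale_left_distrib)
  finally show ?case
    by (intro exI [of _ "scale ?b x + z"]) (simp add: z additive.add [OF additive_euler] add_ac)
qed

section \<open>Brackets with generators and their behaviour under contraction and E\<close>

lemma br_gen_gen:
  assumes "e \<in> B" "e' \<in> B"
  shows "br (gen e) (gen e') = [:scale (gram e e') 1:]"
proof -
  have "coeff (br (gen e) (gen e')) n = (if n = 0 then scale (gram e e') 1 else 0)" for n
  proof -
    have "coeff (br (gen e) (gen e')) n = (\<Sum>f\<in>B. scale (gram e f) (coeff (br (dual f) (gen e')) n))"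
      by (simp add: gen_eq_sum_dual [OF assms(1)] additive.sum [OF additive_br_left] coeff_sum
          coeff_br_scale_left)
    also have "\<dots> = (\<Sum>f\<in>B. if f = e' then (if n = 0 then scale (gram e f) 1 else 0) else 0)"
      by (rule sum.cong [OF refl]) (cases n; simp only: br_dual_gen assms; simp)
    finally show ?thesis
      using finite_B assms by simp
  qed
  then show ?thesis
    by (intro poly_eqI) (simp add: coeff_pCons split: nat.splits)
qed

lemma br_gen_der_gen:
  assumes "e \<in> B" "e' \<in> B"
  shows "br (gen e) ((der ^^ m) (gen e')) = monom (scale (gram e e') 1) m"
proof (induction m)
  case 0
  then show ?case
    by (simp add: br_gen_gen assms monom_0)
next
  case (Suc m)
  then show ?case
    by (simp add: br_del_right lam_del_def monom_Suc map_poly_monom additive.zero [OF additive_der]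
        leibniz_map_scalar [OF leibniz_map_der])
qed

text \<open>By the Leibniz rule the bracket hits either the m-th derivative of \<open>gen f\<close>,
  giving \<lambda>^m times a scalar, so that these terms reassemble q itself, or a coefficient of q.
  The first kind is the origin of the shifts added to E.\<close>

lemma br_gen_taylor:
  assumes e: "e \<in> B" and f: "f \<in> B" and q: "\<And>m. coeff q m \<in> V j"
  shows "br (gen e) (taylor der (gen f) q 0) = map_poly (scale (gram e f)) q
    + map_poly (\<lambda>x. parity_sign (par e * par f) * x)
        (\<Sum>m\<le>degree q. map_poly (\<lambda>z. (der ^^ m) (gen f) * z) (br (gen e) (coeff q m)))"
proof (rule poly_eqI)
  fix n
  have "coeff (br (gen e) (taylor der (gen f) q 0)) n
      = (\<Sum>m\<le>degree q. coeff (br (gen e) ((der ^^ m) (gen f) * coeff q m)) n)"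
    by (simp add: taylor_0 [OF order_refl] additive.sum [OF additive_br_right] coeff_sum)
  also have "\<dots> = (\<Sum>m\<le>degree q. if m = n then scale (gram e f) (coeff q m) else 0)
      + parity_sign (par e * par f) * (\<Sum>m\<le>degree q. (der ^^ m) (gen f) * coeff (br (gen e) (coeff q m)) n)"
    unfolding br_mult_homogeneous [OF gen_par [OF e] der_pow_even [OF gen_par [OF f]] q]
      sum_distrib_left sum.distrib [symmetric]
    by (rule sum.cong [OF refl]) (simp add: br_gen_der_gen e f scale_mult_left)
  also have "(\<Sum>m\<le>degree q. if m = n then scale (gram e f) (coeff q m) else 0) = scale (gram e f) (coeff q n)"
    by (cases "n \<le> degree q") (simp_all add: coeff_eq_0)
  finally show "coeff (br (gen e) (taylor der (gen f) q 0)) n = coeff (map_poly (scale (gram e f)) q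
    + map_poly (\<lambda>x. parity_sign (par e * par f) * x)
        (\<Sum>m\<le>degree q. map_poly (\<lambda>z. (der ^^ m) (gen f) * z) (br (gen e) (coeff q m)))) n"
    by (simp add: coeff_map_poly coeff_sum)
qed

text \<open>The version needed when the contracted element is to stand on the left of the bracket:
  skewsymmetry calls for -\<lambda>-\<partial>, and integration by parts puts the coefficients of q
  on the left as well.\<close>

lemma flip_br_gen_taylor:
  assumes e: "e \<in> B" and f: "f \<in> B" and q: "\<And>m. coeff q m \<in> V j"
  shows "coeff (flip (br (gen e) (taylor der (gen f) q 0))) n = scale (gram e f) (coeff (flip q) n)
    - parity_sign (par e * (par f + j))
        * (\<Sum>m\<le>degree q. taylor der ((der ^^ m) (gen f)) (br (coeff q m) (gen e)) n)"
proof -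
  have "coeff (flip (br (gen e) (taylor der (gen f) q 0))) n = scale (gram e f) (coeff (flip q) n)
      + parity_sign (par e * par f) * (\<Sum>m\<le>degree q.
          - (parity_sign (par e * j) * taylor der ((der ^^ m) (gen f)) (br (coeff q m) (gen e)) n))"
    unfolding br_gen_taylor [OF e f q]
    by (simp add: additive.add [OF additive_flip] flip_scale flip_parity_sign coeff_map_poly
        additive.sum [OF additive_flip] coeff_sum coeff_flip_mult_br [OF gen_par [OF e] q])
  then show ?thesis
    by (simp add: sum_negf distrib_left parity_sign_add sum_distrib_left [symmetric] mult.assoc)
qed

lemma br_scalar:
  assumes "e \<in> B" "e' \<in> B"
  shows "\<exists>c. coeff (br (dual e) (gen e')) n = scale c 1" "\<exists>c. coeff (br (gen e) (gen e')) n = scale c 1"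
proof -
  have "coeff (br (dual e) (gen e')) n = scale (if n = 0 \<and> e = e' then 1 else 0) 1"
    by (cases n) (auto simp: br_dual_gen assms)
  then show "\<exists>c. coeff (br (dual e) (gen e')) n = scale c 1"
    by blast
  have "coeff (br (gen e) (gen e')) n = scale (if n = 0 then gram e e' else 0) 1"
    by (cases n) (auto simp: br_gen_gen assms)
  then show "\<exists>c. coeff (br (gen e) (gen e')) n = scale c 1"
    by blast
qed

text \<open>A bracket with a generator lowers the degree by one. As an operator in y, the commutator
  with E plus the bracket obeys the Leibniz rule. On derivatives of generators the bracket is a
  scalar, which E kills, so the two remaining terms cancel.\<close>

lemma euler_br_gen_left:
  assumes e: "e \<in> B"
  shows "euler (coeff (br (gen e) y) n) = coeff (br (gen e) (euler y)) n - coeff (br (gen e) y) n"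
proof -
  let ?X = "\<lambda>y. coeff (br (gen e) y) n"
  have X: "leibniz_map ?X"
    by (rule leibniz_map_br)
  have "(euler (?X y) - ?X (euler y)) + ?X y = 0"
  proof (rule leibniz_map_eq_0 [where T = "\<lambda>y. (euler (?X y) - ?X (euler y)) + ?X y"])
    show "leibniz_map (\<lambda>y. (euler (?X y) - ?X (euler y)) + ?X y)"
      by (rule leibniz_map_add [OF leibniz_map_commutator [OF leibniz_map_euler euler_even X] X])
    fix e' m
    assume "e' \<in> B"
    then show "(euler (?X ((der ^^ m) (gen e'))) - ?X (euler ((der ^^ m) (gen e')))) + ?X ((der ^^ m) (gen e')) = 0"
      by (simp add: e euler_der_gen br_gen_der_gen leibniz_map_scalar [OF leibniz_map_euler]
          additive.zero [OF additive_euler])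
  qed
  then show ?thesis
    by (simp add: algebra_simps)
qed

text \<open>Skewsymmetry transfers the previous relation to the other argument, because E commutes
  with \<partial> and hence with the substitution of -\<lambda>-\<partial>.\<close>

lemma euler_br_gen_right:
  assumes e: "e \<in> B"
  shows "euler (coeff (br x (gen e)) n) = coeff (br (euler x) (gen e)) n - coeff (br x (gen e)) n"
proof -
  have "euler (coeff (br x (gen e)) n) - (coeff (br (euler x) (gen e)) n - coeff (br x (gen e)) n) = 0"
  proof (rule eq_0_if_homogeneous_parts_0 [where x = x])
    show "additive (\<lambda>x. euler (coeff (br x (gen e)) n) - (coeff (br (euler x) (gen e)) n - coeff (br x (gen e)) n))"
      by (simp add: additive_def additive.add [OF additive_euler] additive.add [OF additive_br_left])
    fix i x
    assume x: "x \<in> V i"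
    have "map_poly euler (flip (br (gen e) x)) = flip (map_poly euler (br (gen e) x))"
      by (rule subst_neg_lam_del_natural [OF additive_euler additive_der additive_der euler_der])
    also have "map_poly euler (br (gen e) x) = br (gen e) (euler x) - br (gen e) x"
      by (rule poly_eqI) (simp add: coeff_map_poly_additive additive_euler euler_br_gen_left e)
    finally have nat: "euler (coeff (flip (br (gen e) x)) n)
        = coeff (flip (br (gen e) (euler x))) n - coeff (flip (br (gen e) x)) n"
      by (metis additive.diff [OF additive_flip] coeff_diff coeff_map_poly_additive [OF additive_euler])
    show "euler (coeff (br x (gen e)) n) - (coeff (br (euler x) (gen e)) n - coeff (br x (gen e)) n) = 0"
      by (simp add: br_skew [OF x gen_par [OF e]] br_skew [OF euler_even [OF x] gen_par [OF e]]
          additive.minus [OF additive_euler] additive_parity_sign [OF additive_euler] nat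
          right_diff_distrib)
  qed
  then show ?thesis
    by simp
qed

text \<open>The form pairs equal parities only, so the sign may be computed from e instead of f and
  leaves the sum.\<close>

lemma sum_gram_parity_sign:
  assumes e: "e \<in> B"
  shows "(\<Sum>f\<in>B. parity_sign (d * par f) * scale (gram e f) (u f))
    = parity_sign (d * par e) * (\<Sum>f\<in>B. scale (gram e f) (u f))"
  unfolding sum_distrib_left
proof (rule sum.cong [OF refl])
  fix f
  assume "f \<in> B"
  then show "parity_sign (d * par f) * scale (gram e f) (u f) = parity_sign (d * par e) * scale (gram e f) (u f)"
    using gram_even [OF e] by (cases "par e = par f") simp_all
qed

subsection \<open>Casimir elements and derivations\<close>

text \<open>Modulo \<partial>V, E x is the sum of the generators times the variational derivatives
  of x. The latter are, up to sign, the brackets of x with \<open>dual e\<close> at \<lambda> = 0,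
  which vanish by assumption.\<close>

lemma euler_in_range_der:
  assumes x: "x \<in> V i" and zero: "\<And>e. e \<in> B \<Longrightarrow> coeff (br x (dual e)) 0 = 0"
  shows "\<exists>z. euler x = der z"
proof -
  have "\<exists>z. taylor der (gen e) (br (dual e) x) 0 = der z" if e: "e \<in> B" for e
  proof -
    let ?s = "parity_sign (i * par e)" and ?p = "map_poly (\<lambda>z. gen e * z) (br x (dual e))"
    obtain y where "coeff (flip ?p) 0 = coeff ?p 0 + der y"
      by (rule coeff_0_subst_neg_lam_del [OF additive_der])
    then have "- (?s * taylor der (gen e) (br (dual e) x) 0) = der y"
      by (simp add: coeff_map_poly zero e coeff_flip_mult_br [OF x dual_par [OF e]])
    then have "taylor der (gen e) (br (dual e) x) 0 = - (?s * der y)"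
      by (metis minus_minus mult_minus_right parity_sign_square)
    also have "\<dots> = der (- (?s * y))"
      by (simp add: additive.minus [OF additive_der] additive_parity_sign [OF additive_der])
    finally show ?thesis ..
  qed
  then obtain z where "\<And>e. e \<in> B \<Longrightarrow> taylor der (gen e) (br (dual e) x) 0 = der (z e)"
    by metis
  then have "euler x = der (\<Sum>e\<in>B. z e)"
    by (simp add: euler_def vf_def additive.sum [OF additive_der])
  then show ?thesis ..
qed

lemma casimir_trivial:
  assumes a: "\<And>b. coeff (br a b) 0 = 0"
  shows "\<exists>c y. a = scale c 1 + der y"
proof -
  obtain x y where xy: "x \<in> V 0" "y \<in> V (0 + 1)" "a = x + y"
    by (rule homogeneous_decomposition)
  have sum: "coeff (br x (dual e)) 0 = - coeff (br y (dual e)) 0" for e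
    using a [of "dual e"] by (simp add: xy(3) additive.add [OF additive_br_left] eq_neg_iff_add_eq_0)
  \<comment> \<open>The brackets of the even and the odd part are negatives of each other but lie in
    different homogeneous parts, so both vanish.\<close>
  have zero: "coeff (br x (dual e)) 0 = 0" if e: "e \<in> B" for e
  proof (rule V_eq_0)
    show "coeff (br x (dual e)) 0 \<in> V (par e)"
      using br_parity [OF xy(1) dual_par [OF e]] by simp
    show "coeff (br x (dual e)) 0 \<in> V (par e + 1)"
      unfolding sum using V_neg [OF br_parity [OF xy(2) dual_par [OF e]]] by (simp add: add.commute)
  qed
  obtain z where z: "euler x = der z"
    using euler_in_range_der [OF xy(1) zero] by auto
  have "coeff (br y (dual e)) 0 = 0" if "e \<in> B" for e
    using sum [of e] zero [OF that] by simp
  then obtain z' where z': "euler y = der z'"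
    using euler_in_range_der [OF xy(2)] by auto
  \<comment> \<open>The scalar in z + z' is killed by \<open>der\<close>, and the rest is E v. As E
    commutes with \<partial>, the equation becomes E a = E \<partial>v, which places a - \<partial>v
    in the kernel of E.\<close>
  obtain c u where u: "u \<in> span (words 1)" "z + z' = scale c 1 + u"
    using scalar_plus_words by blast
  obtain v where v: "u = euler v"
    using words_subset_range_euler [OF u(1)] by auto
  have "euler a = der (z + z')"
    by (simp add: xy(3) z z' additive.add [OF additive_euler] additive.add [OF additive_der])
  also have "\<dots> = euler (der v)"
    by (simp add: u(2) v additive.add [OF additive_der] leibniz_map_scalar [OF leibniz_map_der] euler_der)
  finally have "euler (a - der v) = 0"
    by (simp add: additive.diff [OF additive_euler])
  then obtain c where "a - der v = scale c 1"
    using euler_eq_0_imp_scalar by blast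
  then have "a = scale c 1 + der v"
    by (simp add: diff_eq_eq)
  then show ?thesis
    by blast
qed

section \<open>Derivations are inner\<close>

lemma gen_mult_in_span:
  assumes e: "e \<in> B"
  shows "gen e * x \<in> span (words 1)"
  using words_in_span [of x]
proof (induction rule: span_induct_alt)
  case base
  then show ?case
    by (simp add: span_zero)
next
  case (step c x y)
  obtain w where w: "x = word w" "fst ` set w \<subseteq> B"
    using step.hyps by (auto simp: words_def)
  then have "gen e * x \<in> words 1"
    unfolding words_def using e by (intro CollectI exI [of _ "(e, 0) # w"]) simp
  then show ?case
    using step.IH by (simp add: distrib_left scale_mult_right span_add span_scale span_base)
qed

lemma homogeneous_derivation_inner:
  assumes D: "homogeneous_pva_derivation scale V der br d D"
  shows "\<exists>a. \<forall>x. D x = coeff (br a x) 0"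
proof -
  have prod: "product_derivation scale V d D" and D_der: "\<And>x. D (der x) = der (D x)"
    and D_br: "\<And>i a b n. a \<in> V i \<Longrightarrow>
      D (coeff (br a b) n) = coeff (br (D a) b) n + parity_sign (d * i) * coeff (br a (D b)) n"
    using D by (auto simp: homogeneous_pva_derivation_def)
  have D_leibniz: "leibniz_map D"
    using prod by (rule product_derivation_leibniz_map)
  note addD = leibniz_map_additive [OF D_leibniz]
  have D_par: "x \<in> V i \<Longrightarrow> D x \<in> V (i + d)" for x i
    using prod by (auto simp: product_derivation_def)
  \<comment> \<open>If D were the bracket with a at \<lambda> = 0, then \<open>D (dual f)\<close>
    would be, up to the sign built in here, the variational derivative of a with respect to
    \<open>gen f\<close>. So b would be congruent to E a modulo \<partial>V, and \<partial>V acts by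
    zero at \<lambda> = 0.\<close>
  define b where "b = - (\<Sum>f\<in>B. parity_sign (d * par f) * (gen f * D (dual f)))"
  have b_par: "b \<in> V d"
  proof -
    have "gen f * D (dual f) \<in> V d" if f: "f \<in> B" for f
      using mult_parity [OF gen_par [OF f] D_par [OF dual_par [OF f]]]
      by (cases "par f" rule: bit_cases) (simp_all add: add.assoc [symmetric])
    then show ?thesis
      unfolding b_def by (intro V_neg V_sum_closed V_parity_sign)
  qed
  \<comment> \<open>D kills the scalar bracket of \<open>dual f\<close> and \<open>gen e\<close>;
    its derivation property then relates the two brackets, an integrability condition on the values
    of D.\<close>
  have closed: "br (D (dual f)) (gen e) = - map_poly (\<lambda>x. parity_sign (d * par f) * x) (br (dual f) (D (gen e)))"
    if "e \<in> B" "f \<in> B" for e f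
  proof (rule poly_eqI)
    fix n
    have "D (coeff (br (dual f) (gen e)) n) = 0"
      by (cases n) (auto simp: br_dual_gen that leibniz_map_one [OF D_leibniz] additive.zero [OF addD])
    then show "coeff (br (D (dual f)) (gen e)) n
        = coeff (- map_poly (\<lambda>x. parity_sign (d * par f) * x) (br (dual f) (D (gen e)))) n"
      using D_br [OF dual_par [OF that(2)], of "gen e" n] by (simp add: coeff_map_poly eq_neg_iff_add_eq_0)
  qed
  \<comment> \<open>After skewsymmetry, the terms in which \<open>gen f\<close> is hit add up to
    \<open>D (gen e)\<close> by the expansion of \<open>gen e\<close> in the dual basis. The terms
    in which \<open>D (dual f)\<close> is hit become, by \<open>closed\<close>, the summands of E
    applied to \<open>D (gen e)\<close>.\<close>
  have br_b: "coeff (br b (gen e)) 0 = D (gen e) + euler (D (gen e))" if e: "e \<in> B" for e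
  proof -
    let ?s = "\<lambda>f. parity_sign (d * par f) :: 'v"
    have summand: "coeff (flip (br (gen e) (gen f * D (dual f)))) 0
        = scale (gram e f) (D (dual f)) + ?s f * (?s e * taylor der (gen f) (br (dual f) (D (gen e))) 0)"
      if f: "f \<in> B" for f
    proof -
      have "br (gen e) (gen f * D (dual f)) = [:scale (gram e f) (D (dual f)):]
          + map_poly (\<lambda>x. parity_sign (par e * par f) * x)
              (map_poly (\<lambda>z. gen f * z) (br (gen e) (D (dual f))))" (is "_ = _ + ?q")
        by (rule poly_eqI)
          (simp add: br_mult_homogeneous [OF gen_par [OF e] gen_par [OF f] D_par [OF dual_par [OF f]]]
            coeff_map_poly br_gen_gen e f coeff_pCons scale_mult_left split: nat.splits)
      then have "coeff (flip (br (gen e) (gen f * D (dual f)))) 0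
          = scale (gram e f) (D (dual f)) + coeff (flip ?q) 0"
        by (simp add: additive.add [OF additive_flip])
      also have "coeff (flip ?q) 0 = parity_sign (par e * par f)
          * - (parity_sign (par e * (par f + d)) * taylor der (gen f) (br (D (dual f)) (gen e)) 0)"
        by (simp add: flip_parity_sign coeff_map_poly
            coeff_flip_mult_br [OF gen_par [OF e] D_par [OF dual_par [OF f]]])
      also have "taylor der (gen f) (br (D (dual f)) (gen e)) 0
          = - (?s f * taylor der (gen f) (br (dual f) (D (gen e))) 0)"
        unfolding closed [OF e f]
        by (simp only: additive.minus [OF additive_taylor] taylor_parity_sign)
      finally show ?thesis
        by (cases "par e" rule: bit_cases; cases "par f" rule: bit_cases; cases d rule: bit_cases) simp_all
    qed
    have "br (gen e) b = - (\<Sum>f\<in>B. map_poly (\<lambda>x. ?s f * x) (br (gen e) (gen f * D (dual f))))"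
      by (simp add: b_def additive.minus [OF additive_br_right] additive.sum [OF additive_br_right]
          br_parity_sign_right)
    then have "coeff (flip (br (gen e) b)) 0
        = - (\<Sum>f\<in>B. ?s f * coeff (flip (br (gen e) (gen f * D (dual f)))) 0)"
      by (simp add: additive.minus [OF additive_flip] additive.sum [OF additive_flip] flip_parity_sign
          coeff_sum coeff_map_poly)
    also have "\<dots> = - ((\<Sum>f\<in>B. ?s f * scale (gram e f) (D (dual f))) + ?s e * euler (D (gen e)))"
      by (simp add: summand distrib_left sum.distrib sum_distrib_left euler_def vf_def)
    also have "(\<Sum>f\<in>B. ?s f * scale (gram e f) (D (dual f))) = ?s e * D (gen e)"
      unfolding sum_gram_parity_sign [OF e]
      by (subst gen_eq_sum_dual [OF e]) (simp add: additive.sum [OF addD] leibniz_map_scale [OF D_leibniz])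
    finally show ?thesis
      using br_skew [OF b_par gen_par [OF e], of 0] by (simp add: distrib_left right_diff_distrib)
  qed
  have sign: "parity_sign i * y \<in> span (words 1)" if "y \<in> span (words 1)" for y i
    using that by (cases i rule: bit_cases) (simp_all add: span_neg)
  \<comment> \<open>Every summand of b carries a factor \<open>gen f\<close>, so b has no scalar
    part and E a = b can be solved.\<close>
  have "b \<in> span (words 1)"
    unfolding b_def by (intro span_neg span_sum sign gen_mult_in_span)
  then obtain a where a: "b = euler a"
    using words_subset_range_euler by blast
  have "D x - coeff (br a x) 0 = 0" for x
  proof (rule leibniz_map_eq_0_commuting [where T = "\<lambda>x. D x - coeff (br a x) 0"])
    show "leibniz_map (\<lambda>x. D x - coeff (br a x) 0)"
      by (intro leibniz_map_diff D_leibniz leibniz_map_br)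
    show "D (der x) - coeff (br a (der x)) 0 = der (D x - coeff (br a x) 0)" for x
      by (simp add: D_der br_del_right coeff_lam_del additive_der additive.diff [OF additive_der])
    fix e
    assume e: "e \<in> B"
    have "euler (D (gen e) - coeff (br a (gen e)) 0) + scale (of_nat (Suc 0)) (D (gen e) - coeff (br a (gen e)) 0) = 0"
      using br_b [OF e] by (simp add: a additive.diff [OF additive_euler] euler_br_gen_right e)
    then show "D (gen e) - coeff (br a (gen e)) 0 = 0"
      by (rule euler_plus_eq_0)
  qed
  then show ?thesis
    by (intro exI [of _ a]) simp
qed

end

subsection \<open>First-order deformations\<close>

text \<open>Consequences of the PVA axioms for a deformed bracket, read off at order \<epsilon> on
  elements without \<epsilon>-part; the Jacobi identity becomes the cocycle condition for
  \<open>cbr\<close>.\<close>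

locale pva_cocycle = pva scale V der br
  for scale :: "'k::comm_ring_1 \<Rightarrow> 'v::ring_1 \<Rightarrow> 'v" and V der br +
  fixes cbr :: "'v \<Rightarrow> 'v \<Rightarrow> 'v poly"
  assumes additive_cbr_left: "additive (\<lambda>a. cbr a b)"
    and coeff_cbr_scale_left: "coeff (cbr (scale r a) b) n = scale r (coeff (cbr a b) n)"
    and leibniz_map_cbr: "leibniz_map (\<lambda>b. coeff (cbr a b) n)"
    and cbr_scalar_left: "cbr (scale r 1) b = 0"
    and cbr_parity: "a \<in> V i \<Longrightarrow> b \<in> V j \<Longrightarrow> coeff (cbr a b) n \<in> V (i + j)"
    and cbr_del_right: "cbr a (der b) = lam_del der (cbr a b)"
    and cbr_skew: "a \<in> V i \<Longrightarrow> b \<in> V j \<Longrightarrow>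
      coeff (cbr a b) n = - (parity_sign (i * j) * coeff (flip (cbr b a)) n)"
    and cbr_jacobi: "a \<in> V i \<Longrightarrow> b \<in> V j \<Longrightarrow>
      coeff (cbr a (coeff (br b c) n)) m + coeff (br a (coeff (cbr b c) n)) m
        - parity_sign (i * j) *
          (coeff (cbr b (coeff (br a c) m)) n + coeff (br b (coeff (cbr a c) m)) n)
      = (\<Sum>k\<le>m. of_nat ((m - k + n) choose n) *
          (coeff (cbr (coeff (br a b) k) c) (m - k + n) + coeff (br (coeff (cbr a b) k) c) (m - k + n)))"

lemma std_part_simps [simp]:
  "std_part 0 = 0" "std_part (x + y) = std_part x + std_part y"
  "std_part (x - y) = std_part x - std_part y" "std_part (- x) = - std_part x"
  "std_part 1 = 1" "std_part (u * v) = std_part u * std_part v"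
  by (simp_all add: zero_dual_num_def plus_dual_num_def minus_dual_num_def uminus_dual_num_def
      one_dual_num_def times_dual_num_def)

lemma eps_part_simps [simp]:
  "eps_part 0 = 0" "eps_part (x + y) = eps_part x + eps_part y"
  "eps_part (x - y) = eps_part x - eps_part y" "eps_part (- x) = - eps_part x"
  "eps_part 1 = 0" "eps_part (u * v) = std_part u * eps_part v + eps_part u * std_part v"
  by (simp_all add: zero_dual_num_def plus_dual_num_def minus_dual_num_def uminus_dual_num_def
      one_dual_num_def times_dual_num_def)

lemma dual_num_parity_sign [simp]:
  "std_part (parity_sign i) = parity_sign i" "eps_part (parity_sign i) = 0"
  by (cases i rule: bit_cases; simp)+

lemma dual_num_of_nat [simp]: "std_part (of_nat k) = of_nat k" "eps_part (of_nat k) = 0"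
  by (induction k) simp_all

lemma additive_eps_part: "additive eps_part"
  by (simp add: additive.intro)

lemma coeff_dual_bracket:
  "coeff (dual_bracket br cbr x y) n = Dual (coeff (br (std_part x) (std_part y)) n)
     (coeff (br (eps_part x) (std_part y)) n + coeff (br (std_part x) (eps_part y)) n
       + coeff (cbr (std_part x) (std_part y)) n)"
  unfolding dual_bracket_def
  by (simp add: coeff_map_poly zero_dual_num_def [symmetric]) (simp add: plus_dual_num_def)

context pva
begin

text \<open>Each condition is the \<epsilon>-part of an axiom or a proved fact of the structure over
  the dual numbers, evaluated at elements \<open>Dual a 0\<close>. For skewsymmetry,
  \<open>eps_part\<close> intertwines the two derivations.\<close>

lemma first_order_deformation_cocycle:
  assumes "first_order_deformation scale V der br cbr"
  shows "pva_cocycle scale V der br cbr"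
proof -
  interpret dual: pva "dual_scale scale" "dual_parts V" "map_dual_num der" "dual_bracket br cbr"
    using assms by (simp add: first_order_deformation_def)
  have br0 [simp]: "br 0 b = 0" "br a 0 = 0" for a b
    by (rule additive.zero [OF additive_br_left], rule additive.zero [OF additive_br_right])
  have eps: "eps_part (coeff (dual_bracket br cbr (Dual a 0) (Dual b 0)) n) = coeff (cbr a b) n" for a b n
    by (simp add: coeff_dual_bracket)
  have add: "Dual (a + b) 0 = Dual a 0 + Dual b 0" for a b :: 'v
    by (simp add: plus_dual_num_def)
  have sc: "Dual (scale c a) 0 = dual_scale scale (Dual c 0) (Dual a 0)" for c a
    by (simp add: dual_scale_def)
  have mult: "Dual (a * b) 0 = Dual a 0 * Dual b 0" for a b :: 'v
    by (simp add: times_dual_num_def)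
  have one: "(1 :: 'v dual_num) = Dual 1 0"
    by (simp add: one_dual_num_def)
  have par: "Dual a 0 \<in> dual_parts V i" if "a \<in> V i" for a i
    using that V_zero by (auto simp: dual_parts_def)
  have der_dual: "map_dual_num der (Dual a 0) = Dual (der a) 0" for a
    by (simp add: additive.zero [OF additive_der])
  show ?thesis
  proof unfold_locales
    show add_left: "cbr (a + b) c = cbr a c + cbr b c" for a b c
      by (rule poly_eqI)
        (simp only: eps [symmetric] add additive.add [OF dual.additive_br_left] coeff_add eps_part_simps)
    show "coeff (cbr (scale c a) b) n = scale c (coeff (cbr a b) n)" for c a b n
      unfolding eps [symmetric] sc dual.coeff_br_scale_left by (simp add: dual_scale_def)
    show "leibniz_map (\<lambda>b. coeff (cbr a b) n)" for a n
    proof (rule leibniz_mapI)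
      show "coeff (cbr a (x + y)) n = coeff (cbr a x) n + coeff (cbr a y) n" for x y
        by (simp only: eps [symmetric] add additive.add [OF dual.additive_br_right] coeff_add eps_part_simps)
      show "coeff (cbr a (scale c x)) n = scale c (coeff (cbr a x) n)" for c x
        unfolding eps [symmetric] sc dual.coeff_br_scale_right by (simp add: dual_scale_def)
      fix i j b c
      assume "b \<in> V i" "c \<in> V j"
      then show "coeff (cbr a (b * c)) n
          = coeff (cbr a b) n * c + parity_sign (i * j) * (coeff (cbr a c) n * b)"
        using arg_cong [OF dual.br_leibniz [OF par par, of b i c j "Dual a 0" n], of eps_part]
        by (simp add: mult [symmetric] eps)
    qed
    show "cbr (scale c 1) b = 0" for c b
      by (rule poly_eqI) (simp only: eps [symmetric] sc one [symmetric] dual.br_scalar_left, simp)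
    show "coeff (cbr a b) n \<in> V (i + j)" if "a \<in> V i" "b \<in> V j" for a b i j n
      using dual.br_parity [OF that [THEN par], of n]
      by (auto simp: dual_parts_def coeff_dual_bracket)
    show "cbr a (der b) = lam_del der (cbr a b)" for a b
    proof (rule poly_eqI)
      fix n
      show "coeff (cbr a (der b)) n = coeff (lam_del der (cbr a b)) n"
        unfolding eps [symmetric] der_dual [symmetric] dual.br_del_right coeff_lam_del [OF dual.additive_der]
        by (simp add: coeff_dual_bracket coeff_lam_del additive_der dual_num.map_sel)
    qed
    show "coeff (cbr a b) n = - (parity_sign (i * j) * coeff (flip (cbr b a)) n)"
      if "a \<in> V i" "b \<in> V j" for a b i j n
    proof -
      have "map_poly eps_part (dual.flip (dual_bracket br cbr (Dual b 0) (Dual a 0)))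
          = flip (map_poly eps_part (dual_bracket br cbr (Dual b 0) (Dual a 0)))"
        by (rule subst_neg_lam_del_natural [OF additive_eps_part dual.additive_der additive_der])
          (simp add: dual_num.map_sel)
      also have "map_poly eps_part (dual_bracket br cbr (Dual b 0) (Dual a 0)) = cbr b a"
        by (rule poly_eqI) (simp add: coeff_map_poly eps)
      finally have "eps_part (coeff (dual.flip (dual_bracket br cbr (Dual b 0) (Dual a 0))) n)
          = coeff (flip (cbr b a)) n"
        by (metis coeff_map_poly_additive [OF additive_eps_part])
      then show ?thesis
        using arg_cong [OF dual.br_skew [OF that [THEN par], of n], of eps_part] by (simp add: eps)
    qed
    show "coeff (cbr a (coeff (br b c) n)) m + coeff (br a (coeff (cbr b c) n)) m
        - parity_sign (i * j) *
          (coeff (cbr b (coeff (br a c) m)) n + coeff (br b (coeff (cbr a c) m)) n)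
      = (\<Sum>k\<le>m. of_nat ((m - k + n) choose n) *
          (coeff (cbr (coeff (br a b) k) c) (m - k + n) + coeff (br (coeff (cbr a b) k) c) (m - k + n)))"
      if "a \<in> V i" "b \<in> V j" for a b c i j m n
      using arg_cong [OF dual.br_jacobi [OF that [THEN par], of "Dual c 0" n m], of eps_part]
      by (simp add: coeff_dual_bracket additive.sum [OF additive_eps_part] add.commute)
  qed
qed

end

section \<open>Homotopy formula for cocycles and triviality of deformations\<close>

locale superfermion_cocycle =
  superfermion scale V der br B gen dual par gram + pva_cocycle scale V der br cbr
  for scale :: "'f::field_char_0 \<Rightarrow> 'v::ring_1 \<Rightarrow> 'v" and V der br
    and B :: "'b set" and gen dual par gram cbr
begin

text \<open>Brackets of generators are scalars, on which the cocycle vanishes in either argument. Of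
  the six terms of the cocycle condition only the three with the cocycle inside survive.\<close>

lemma cbr_jacobi_gen:
  assumes f: "f \<in> B" and b: "b \<in> B" and c: "c \<in> B"
  shows "coeff (br (dual f) (coeff (cbr (gen b) (gen c)) n)) m
    = parity_sign (par f * par b) * coeff (br (gen b) (coeff (cbr (dual f) (gen c)) m)) n
      + (\<Sum>k\<le>m. of_nat ((m - k + n) choose n) *
          coeff (br (coeff (cbr (dual f) (gen b)) k) (gen c)) (m - k + n))"
proof -
  have right: "coeff (cbr x (scale r 1)) l = 0" for x r l
    by (rule leibniz_map_scalar [OF leibniz_map_cbr])
  obtain r where r: "coeff (br (gen b) (gen c)) n = scale r 1"
    using br_scalar b c by blast
  obtain s where s: "coeff (br (dual f) (gen c)) m = scale s 1"
    using br_scalar f c by blast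
  have left: "cbr (coeff (br (dual f) (gen b)) k) x = 0" for k x
    using br_scalar(1) [OF f b, of k] by (auto simp: cbr_scalar_left)
  show ?thesis
    using cbr_jacobi [OF dual_par [OF f] gen_par [OF b], of "gen c" n m]
    by (simp add: r s left right diff_eq_eq add.commute)
qed

text \<open>The summand of E belonging to \<open>gen f\<close>, applied to a value of the cocycle,
  is rewritten by the reduced Jacobi identity. The two resulting terms are those that appear when
  the contractions of the cocycle are bracketed with generators.\<close>

lemma taylor_br_cbr:
  assumes f: "f \<in> B" and b: "b \<in> B" and c: "c \<in> B"
  shows "taylor der (gen f) (br (dual f) (coeff (cbr (gen b) (gen c)) n)) 0
    = parity_sign (par f * par b) * (\<Sum>m\<le>degree (cbr (dual f) (gen c)).
          (der ^^ m) (gen f) * coeff (br (gen b) (coeff (cbr (dual f) (gen c)) m)) n)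
      + (\<Sum>k\<le>degree (cbr (dual f) (gen b)).
          taylor der ((der ^^ k) (gen f)) (br (coeff (cbr (dual f) (gen b)) k) (gen c)) n)"
    (is "?L = ?s * (\<Sum>m\<le>?M. ?t m) + (\<Sum>k\<le>?K. ?u k)")
proof -
  have br0 [simp]: "br 0 x = 0" "br x 0 = 0" for x
    by (rule additive.zero [OF additive_br_left], rule additive.zero [OF additive_br_right])
  obtain N0 where N0: "\<And>N. N \<ge> N0 \<Longrightarrow>
    (\<Sum>m\<le>N. (der ^^ m) (gen f) * (\<Sum>k\<le>m. of_nat ((m - k + n) choose n) *
       coeff (br (coeff (cbr (dual f) (gen b)) k) (gen c)) (m - k + n))) = (\<Sum>k\<le>?K. ?u k)"
    by (rule sum_taylor_eq_convolution [of ?K "\<lambda>k. br (coeff (cbr (dual f) (gen b)) k) (gen c)" der "gen f" n])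
      (auto simp: coeff_eq_0)
  \<comment> \<open>One bound beyond which the summands of all three sums over m contribute nothing
    new.\<close>
  define N where "N = Max {N0, ?M, degree (br (dual f) (coeff (cbr (gen b) (gen c)) n))}"
  have N: "N0 \<le> N" "?M \<le> N" "degree (br (dual f) (coeff (cbr (gen b) (gen c)) n)) \<le> N"
    by (auto simp: N_def)
  have "?L = (\<Sum>m\<le>N. (der ^^ m) (gen f) * coeff (br (dual f) (coeff (cbr (gen b) (gen c)) n)) m)"
    by (rule taylor_0 [OF N(3)])
  also have "\<dots> = ?s * (\<Sum>m\<le>N. ?t m) + (\<Sum>k\<le>?K. ?u k)"
    unfolding cbr_jacobi_gen [OF f b c] N0 [OF N(1), symmetric] sum_distrib_left [of ?s] sum.distrib [symmetric]
    by (rule sum.cong [OF refl]) (cases "par f" rule: bit_cases; cases "par b" rule: bit_cases; simp add: distrib_left right_diff_distrib)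
  also have "(\<Sum>m\<le>N. ?t m) = (\<Sum>m\<le>?M. ?t m)"
    by (rule sum.mono_neutral_right) (use N in \<open>auto simp: coeff_eq_0\<close>)
  finally show ?thesis .
qed

text \<open>The contraction of the cocycle with the Euler vector field.\<close>

definition contraction :: "'b \<Rightarrow> 'v" where
  "contraction e = (\<Sum>f\<in>B. taylor der (gen f) (cbr (dual f) (gen e)) 0)"

lemma contraction_par:
  assumes e: "e \<in> B"
  shows "contraction e \<in> V (par e)"
  unfolding contraction_def
proof (rule V_sum_closed)
  fix f
  assume f: "f \<in> B"
  have "taylor der (gen f) (cbr (dual f) (gen e)) 0 \<in> V (par f + (par f + par e))"
    by (intro taylor_parity cbr_parity dual_par gen_par e f)
  then show "taylor der (gen f) (cbr (dual f) (gen e)) 0 \<in> V (par e)"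
    by (cases "par f" rule: bit_cases) (simp_all add: add.assoc [symmetric])
qed

lemma cbr_gen_eq_sum:
  assumes e: "e \<in> B"
  shows "cbr (gen e) x = (\<Sum>f\<in>B. map_poly (scale (gram e f)) (cbr (dual f) x))"
  by (rule poly_eqI)
    (simp add: gen_eq_sum_dual [OF e] additive.sum [OF additive_cbr_left] coeff_sum coeff_cbr_scale_left
      coeff_map_poly)

text \<open>The Jacobi identity writes E of the cocycle value as X + Y. Each of the two brackets on
  the left yields one of X and Y plus one copy of the cocycle value, from hitting the prefactor
  \<open>gen f\<close>; hence the summand with factor 2.\<close>

lemma contraction_homotopy:
  assumes b: "b \<in> B" and c: "c \<in> B"
  shows "coeff (br (contraction b) (gen c)) n + coeff (br (gen b) (contraction c)) n
    = euler (coeff (cbr (gen b) (gen c)) n) + scale 2 (coeff (cbr (gen b) (gen c)) n)"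
proof -
  let ?Q = "coeff (cbr (gen b) (gen c)) n"
  define X where "X = (\<Sum>f\<in>B. parity_sign (par f * par b) * (\<Sum>m\<le>degree (cbr (dual f) (gen c)).
          (der ^^ m) (gen f) * coeff (br (gen b) (coeff (cbr (dual f) (gen c)) m)) n))"
  define Y where "Y = (\<Sum>f\<in>B. \<Sum>k\<le>degree (cbr (dual f) (gen b)).
          taylor der ((der ^^ k) (gen f)) (br (coeff (cbr (dual f) (gen b)) k) (gen c)) n)"
  have "euler ?Q = X + Y"
    by (simp add: euler_def vf_def X_def Y_def taylor_br_cbr b c sum.distrib)
  moreover have "coeff (br (gen b) (contraction c)) n = ?Q + X"
  proof -
    have "coeff (br (gen b) (contraction c)) n
        = (\<Sum>f\<in>B. coeff (br (gen b) (taylor der (gen f) (cbr (dual f) (gen c)) 0)) n)"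
      by (simp add: contraction_def additive.sum [OF additive_br_right] coeff_sum)
    also have "\<dots> = (\<Sum>f\<in>B. scale (gram b f) (coeff (cbr (dual f) (gen c)) n)) + X"
      unfolding X_def sum.distrib [symmetric]
      by (rule sum.cong [OF refl])
        (simp add: br_gen_taylor [OF b _ cbr_parity [OF dual_par gen_par [OF c]]] coeff_map_poly coeff_sum
          mult.commute [of "par b"])
    also have "(\<Sum>f\<in>B. scale (gram b f) (coeff (cbr (dual f) (gen c)) n)) = ?Q"
      by (simp add: cbr_gen_eq_sum [OF b] coeff_sum coeff_map_poly)
    finally show ?thesis .
  qed
  \<comment> \<open>Here skewsymmetry is used twice: for the bracket, to bring
    \<open>contraction b\<close> to the right, and for the cocycle, to recognise the flipped value
    at (c, b) as the value at (b, c).\<close>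
  moreover have "coeff (br (contraction b) (gen c)) n = ?Q + Y"
  proof -
    let ?s = "parity_sign (par b * par c) :: 'v"
    have "coeff (flip (br (gen c) (contraction b))) n
        = (\<Sum>f\<in>B. coeff (flip (br (gen c) (taylor der (gen f) (cbr (dual f) (gen b)) 0))) n)"
      by (simp add: contraction_def additive.sum [OF additive_br_right] additive.sum [OF additive_flip] coeff_sum)
    also have "\<dots> = (\<Sum>f\<in>B. scale (gram c f) (coeff (flip (cbr (dual f) (gen b))) n)) - ?s * Y"
      unfolding Y_def sum_distrib_left [of ?s _ B] sum_subtractf [symmetric]
    proof (rule sum.cong [OF refl])
      fix f
      assume f: "f \<in> B"
      have "par c * (par f + (par f + par b)) = par b * par c"
        by (cases "par f" rule: bit_cases) (simp_all add: add.assoc [symmetric] mult.commute)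
      then show "coeff (flip (br (gen c) (taylor der (gen f) (cbr (dual f) (gen b)) 0))) n
          = scale (gram c f) (coeff (flip (cbr (dual f) (gen b))) n)
            - ?s * (\<Sum>k\<le>degree (cbr (dual f) (gen b)).
                taylor der ((der ^^ k) (gen f)) (br (coeff (cbr (dual f) (gen b)) k) (gen c)) n)"
        by (simp only: flip_br_gen_taylor [OF c f cbr_parity [OF dual_par [OF f] gen_par [OF b]]])
    qed
    also have "(\<Sum>f\<in>B. scale (gram c f) (coeff (flip (cbr (dual f) (gen b))) n))
        = coeff (flip (cbr (gen c) (gen b))) n"
      by (simp add: cbr_gen_eq_sum [OF c] additive.sum [OF additive_flip] coeff_sum flip_scale)
    finally show ?thesis
      using br_skew [OF contraction_par [OF b] gen_par [OF c], of n]
        cbr_skew [OF gen_par [OF b] gen_par [OF c], of n]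
      by (simp add: right_diff_distrib)
  qed
  ultimately show ?thesis
    using scale_left_distrib [of 1 1 ?Q] by simp
qed

text \<open>A bracket with a generator lowers the degree by one, so E + 1 applied inside it comes
  out as E + 2. Solving (E + 1) P = contraction therefore matches the homotopy formula, and E + 2 is
  cancelled by injectivity.\<close>

lemma cocycle_is_coboundary_on_gen:
  obtains P where "\<And>e. e \<in> B \<Longrightarrow> P e \<in> V (par e)"
    and "\<And>b c n. b \<in> B \<Longrightarrow> c \<in> B \<Longrightarrow>
      coeff (cbr (gen b) (gen c)) n = coeff (br (P b) (gen c)) n + coeff (br (gen b) (P c)) n"
proof -
  have "\<forall>e. \<exists>y. contraction e = euler y + y"
    using euler_plus_one_surj by blast
  then obtain P where P: "\<And>e. contraction e = euler (P e) + P e"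
    by (auto dest: choice)
  have par: "P e \<in> V (par e)" if "e \<in> B" for e
  proof (rule inverse_image_homogeneous [where T = "\<lambda>x. euler x + x"])
    show "additive (\<lambda>x. euler x + x)"
      by (simp add: additive_def additive.add [OF additive_euler])
    show "y = 0" if "euler y + y = 0" for y
      using euler_plus_eq_0 [of y 0] that by simp
    show "euler x + x \<in> V i" if "x \<in> V i" for i x
      by (intro V_add euler_even that)
    show "euler (P e) + P e \<in> V (par e)"
      using contraction_par [OF that] by (simp add: P)
  qed
  have "coeff (cbr (gen b) (gen c)) n = coeff (br (P b) (gen c)) n + coeff (br (gen b) (P c)) n"
    if b: "b \<in> B" and c: "c \<in> B" for b c n
  proof -
    let ?Q = "coeff (cbr (gen b) (gen c)) n"
    let ?R = "coeff (br (P b) (gen c)) n + coeff (br (gen b) (P c)) n"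
    have two: "scale 2 x = x + x" for x
      using scale_left_distrib [of 1 1 x] by simp
    have "euler ?R + scale 2 ?R = euler ?Q + scale 2 ?Q"
      unfolding contraction_homotopy [OF b c, symmetric]
      by (simp add: P two additive.add [OF additive_euler] euler_br_gen_left b euler_br_gen_right c
          additive.add [OF additive_br_left] additive.add [OF additive_br_right])
    then have "euler (?Q - ?R) + scale (of_nat (Suc 1)) (?Q - ?R) = 0"
      by (simp add: additive.diff [OF additive_euler] scale_right_diff_distrib algebra_simps)
    then show ?thesis
      using euler_plus_eq_0 [of "?Q - ?R" 1] by simp
  qed
  with par show thesis
    by (rule that)
qed

text \<open>The defect C between the cocycle and the coboundary of D obeys the Leibniz rule and
  sesquilinearity in its second argument and is skewsymmetric. Vanishing on pairs of generators thus
  extends to the second argument, then by skewsymmetry to a generator on the right of an arbitrary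
  element, and once more to all pairs.\<close>

lemma cocycle_is_coboundary:
  obtains D where "product_derivation scale V 0 D" "\<And>x. D (der x) = der (D x)"
    "\<And>x y n. coeff (cbr x y) n + D (coeff (br x y) n) = coeff (br (D x) y) n + coeff (br x (D y)) n"
proof -
  obtain P where P_par: "\<And>e. e \<in> B \<Longrightarrow> P e \<in> V (par e)"
    and P: "\<And>b c n. b \<in> B \<Longrightarrow> c \<in> B \<Longrightarrow>
      coeff (cbr (gen b) (gen c)) n = coeff (br (P b) (gen c)) n + coeff (br (gen b) (P c)) n"
    using cocycle_is_coboundary_on_gen by blast
  define D where "D = vf P"
  have D: "leibniz_map D" and D_der: "\<And>x. D (der x) = der (D x)"
    and D_gen: "\<And>e. e \<in> B \<Longrightarrow> D (gen e) = P e"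
    by (simp_all add: D_def leibniz_map_vf vf_der vf_gen)
  have D_even: "x \<in> V i \<Longrightarrow> D x \<in> V i" for x i
    unfolding D_def by (rule vf_even [OF P_par])
  note addD = leibniz_map_additive [OF D]
  \<comment> \<open>The terms are grouped as a difference of Leibniz maps plus a commutator with the
    even map D, the two forms for which the Leibniz rule has been established.\<close>
  define C where "C x y = (cbr x y - br (D x) y) + (map_poly D (br x y) - br x (D y))" for x y
  have coeff_C: "coeff (C x y) n = (coeff (cbr x y) n - coeff (br (D x) y) n)
      + (D (coeff (br x y) n) - coeff (br x (D y)) n)" for x y n
    by (simp add: C_def coeff_map_poly_additive [OF addD])
  have C_leibniz: "leibniz_map (\<lambda>y. coeff (C x y) n)" for x n
    unfolding coeff_C
    by (rule leibniz_map_add [OF leibniz_map_diff [OF leibniz_map_cbr leibniz_map_br]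
          leibniz_map_commutator [OF D D_even leibniz_map_br]])
  have C_der: "C x (der y) = lam_del der (C x y)" for x y
    by (rule poly_eqI)
      (simp add: coeff_C D_der cbr_del_right br_del_right coeff_lam_del additive_der additive.add [OF addD]
        additive.add [OF additive_der] additive.diff [OF additive_der] additive.zero [OF addD])
  have C_vanish: "C x y = 0" if "\<And>e. e \<in> B \<Longrightarrow> C x (gen e) = 0" for x y
  proof (rule poly_eqI)
    fix n
    have "coeff (C x y) n = 0"
    proof (rule leibniz_map_eq_0 [OF C_leibniz])
      fix e m
      assume "e \<in> B"
      then have "C x ((der ^^ m) (gen e)) = 0"
        by (induction m) (simp_all add: that C_der)
      then show "coeff (C x ((der ^^ m) (gen e))) n = 0"
        by simp
    qed
    then show "coeff (C x y) n = coeff 0 n"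
      by simp
  qed
  have C_skew: "coeff (C x y) n = - (parity_sign (i * j) * coeff (flip (C y x)) n)"
    if x: "x \<in> V i" and y: "y \<in> V j" for x y i j n
  proof -
    have "map_poly D (flip (br y x)) = flip (map_poly D (br y x))"
      by (rule subst_neg_lam_del_natural [OF addD additive_der additive_der D_der])
    then have "D (coeff (flip (br y x)) n) = coeff (flip (map_poly D (br y x))) n"
      by (metis coeff_map_poly_additive [OF addD])
    then show ?thesis
      by (simp add: coeff_C C_def [of y x] cbr_skew [OF x y] br_skew [OF x y] br_skew [OF D_even [OF x] y]
          br_skew [OF x D_even [OF y]] additive.add [OF additive_flip] additive.diff [OF additive_flip]
          additive.minus [OF addD] additive_parity_sign [OF addD] algebra_simps)
  qed
  have C_gen: "C (gen e) y = 0" if e: "e \<in> B" for e y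
  proof (rule C_vanish, rule poly_eqI)
    fix f n
    assume f: "f \<in> B"
    have "D (coeff (br (gen e) (gen f)) n) = 0"
      using br_scalar(2) [OF e f, of n] by (auto simp: leibniz_map_scalar [OF D])
    then show "coeff (C (gen e) (gen f)) n = coeff 0 n"
      by (simp add: coeff_C P e f D_gen)
  qed
  have "C x y = 0" for x y
  proof (rule C_vanish)
    fix e
    assume e: "e \<in> B"
    show "C x (gen e) = 0"
    proof (rule eq_0_if_homogeneous_parts_0 [where T = "\<lambda>x. C x (gen e)"])
      show "additive (\<lambda>x. C x (gen e))"
        by (simp add: additive_def C_def additive.add [OF additive_cbr_left] additive.add [OF additive_br_left]
            additive.add [OF addD] additive.add [OF additive_map_poly [OF addD]])
      show "C x (gen e) = 0" if "x \<in> V i" for i x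
        by (rule poly_eqI)
          (simp add: C_skew [OF that gen_par [OF e]] C_gen [OF e] additive.zero [OF additive_flip])
    qed
  qed
  then have "coeff (cbr x y) n + D (coeff (br x y) n) = coeff (br (D x) y) n + coeff (br x (D y)) n" for x y n
    using coeff_C [of x y n] by (simp add: algebra_simps)
  moreover have "product_derivation scale V 0 D"
    using D D_even by (rule leibniz_map_product_derivation)
  ultimately show thesis
    using D_der that by blast
qed

text \<open>At order \<epsilon>, compatibility of id + \<epsilon>D with the brackets is exactly the
  coboundary equation for the standard parts; the terms with an \<epsilon>-part in an argument agree
  on both sides.\<close>

lemma deformation_trivial: "trivial_deformation scale V der br cbr"
proof -
  obtain D where D: "product_derivation scale V 0 D" "\<And>x. D (der x) = der (D x)"
    and eq: "\<And>x y n. coeff (cbr x y) n + D (coeff (br x y) n) = coeff (br (D x) y) n + coeff (br x (D y)) n"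
    using cocycle_is_coboundary by blast
  note addD = leibniz_map_additive [OF product_derivation_leibniz_map [OF D(1)]]
  have "map_poly (dual_exp D) (dual_bracket br cbr x y)
      = dual_bracket br (\<lambda>_ _. 0) (dual_exp D x) (dual_exp D y)" for x y
  proof (rule poly_eqI)
    fix n
    have "dual_exp D 0 = 0"
      by (simp add: dual_exp_def additive.zero [OF addD] zero_dual_num_def)
    then show "coeff (map_poly (dual_exp D) (dual_bracket br cbr x y)) n
        = coeff (dual_bracket br (\<lambda>_ _. 0) (dual_exp D x) (dual_exp D y)) n"
      using eq [of "std_part x" "std_part y" n]
      by (simp add: coeff_map_poly coeff_dual_bracket dual_exp_def additive.add [OF additive_br_left]
          additive.add [OF additive_br_right] algebra_simps)
  qed
  then show ?thesis
    unfolding trivial_deformation_def equivalent_deformations_def using D by blast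
qed

end

subsection \<open>The free superfermion PVA in coordinates\<close>

context skew_superspace
begin

text \<open>A basis is chosen among the homogeneous vectors. Nondegeneracy makes the map T attached
  to the form injective, finite dimension makes it surjective, and \<open>dual e\<close> is the
  preimage of e. Evenness of the form makes T even, so dual vectors inherit parities.\<close>

lemma homogeneous_dual_bases:
  obtains B par dual where "finite B" "span B = UNIV" "\<And>e. e \<in> B \<Longrightarrow> e \<in> H (par e)"
    "\<And>e. e \<in> B \<Longrightarrow> dual e \<in> H (par e)"
    "\<And>e e'. e \<in> B \<Longrightarrow> e' \<in> B \<Longrightarrow> form (dual e) e' = (if e = e' then 1 else 0)"
    "\<And>a. a = (\<Sum>e\<in>B. scaleH (form a e) (dual e))"
proof -
  interpret vs: vector_space scaleH
    by (rule module_axioms [unfolded module_iff_vector_space])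
  obtain B where B: "B \<subseteq> H 0 \<union> H 1" "independent B" "H 0 \<union> H 1 \<subseteq> span B"
    by (rule vs.maximal_independent_subset)
  have span_B: "span B = UNIV"
  proof -
    have "v \<in> span B" for v
      using V_sum [of v] B(3) by (auto intro: span_add)
    then show ?thesis
      by blast
  qed
  have fin: "finite B"
    using finite_dim vs.independent_span_bound [OF _ B(2)] by blast
  interpret fd: finite_dimensional_vector_space scaleH B
    by unfold_locales (use fin B(2) span_B in auto)
  have "\<forall>e\<in>B. \<exists>i. e \<in> H i"
    using B(1) by blast
  then obtain par where par: "\<And>e. e \<in> B \<Longrightarrow> e \<in> H (par e)"
    by metis
  have form_add: "form (a + b) c = form a c + form b c" "form a (b + c) = form a b + form a c"
    and form_scale: "form (scaleH r a) b = r * form a b" "form a (scaleH r b) = r * form a b" for a b c r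
    using form_linear_left form_linear_right by (simp_all add: module_hom_iff)
  have form_zero: "form a 0 = 0" for a
    using form_add(2) [of a 0 0] by simp
  have nondeg: "a = 0" if "\<And>e. e \<in> B \<Longrightarrow> form a e = 0" for a
  proof (rule form_nondegenerate)
    fix b
    have "b \<in> span B"
      by (simp add: span_B)
    then show "form a b = 0"
      by (induction rule: span_induct_alt) (simp_all add: form_zero form_add form_scale that)
  qed
  define T where "T a = (\<Sum>e\<in>B. scaleH (form a e) e)" for a
  have addT: "additive T"
    by (simp add: additive_def T_def form_add scale_left_distrib sum.distrib)
  have coord: "f e = 0" if "(\<Sum>e\<in>B. scaleH (f e) e) = 0" "e \<in> B" for f e
    using independentD [OF B(2) fin order_refl that] .
  have T_0: "a = 0" if "T a = 0" for a
    using coord [OF that [unfolded T_def]] by (rule nondeg)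
  have "Vector_Spaces.linear scaleH scaleH T"
    by (simp add: Vector_Spaces.linear_iff vs.vector_space_axioms additive.add [OF addT])
      (simp add: T_def form_scale scale_sum_right)
  moreover have "inj T"
    by (rule injI) (metis T_0 additive.diff [OF addT] eq_iff_diff_eq_0)
  ultimately have "surj T"
    by (rule fd.linear_inj_imp_surj)
  then have "\<forall>e. \<exists>a. T a = e"
    by (metis surjD)
  then obtain dual where dual: "\<And>e. T (dual e) = e"
    by metis
  have dual_par: "dual e \<in> H (par e)" if e: "e \<in> B" for e
  proof (rule inverse_image_homogeneous [OF addT T_0])
    fix i x
    assume x: "x \<in> H i"
    show "T x \<in> H i"
      unfolding T_def
    proof (rule V_sum_closed)
      fix f
      assume f: "f \<in> B"
      show "scaleH (form x f) f \<in> H i"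
        using form_even [OF x par [OF f]] par [OF f]
        by (cases "i = par f") (auto intro: V_scale V_zero)
    qed
  qed (simp_all add: dual par e)
  have form_dual: "form (dual e) e' = (if e = e' then 1 else 0)" if "e \<in> B" "e' \<in> B" for e e'
  proof -
    have "(\<Sum>f\<in>B. scaleH (if f = e then 1 else 0) f) = (\<Sum>f\<in>B. if f = e then f else 0)"
      by (rule sum.cong) auto
    also have "\<dots> = e"
      using fin that by simp
    finally have "(\<Sum>f\<in>B. scaleH (form (dual e) f - (if f = e then 1 else 0)) f) = 0"
      using dual [of e] by (simp add: scale_left_diff_distrib sum_subtractf T_def)
    from coord [OF this that(2)] show ?thesis
      by (simp split: if_splits)
  qed
  have expand: "a = (\<Sum>e\<in>B. scaleH (form a e) (dual e))" for a
  proof -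
    have add: "additive (\<lambda>x. form x f)" for f
      by (simp add: additive_def form_add)
    have "a - (\<Sum>e\<in>B. scaleH (form a e) (dual e)) = 0"
    proof (rule nondeg)
      fix f
      assume f: "f \<in> B"
      have "form (\<Sum>e\<in>B. scaleH (form a e) (dual e)) f = (\<Sum>e\<in>B. if e = f then form a e else 0)"
        unfolding additive.sum [OF add] form_scale
        by (rule sum.cong) (simp_all add: form_dual f)
      then show "form (a - (\<Sum>e\<in>B. scaleH (form a e) (dual e))) f = 0"
        using fin f by (simp add: additive.diff [OF add])
    qed
    then show ?thesis
      by simp
  qed
  show thesis
    by (rule that [OF fin span_B par dual_par form_dual expand])
qed

end

lemma module_poly_mapping:
  "module (\<lambda>c. Poly_Mapping.map ((*) c) :: ('b \<Rightarrow>\<^sub>0 'a::field) \<Rightarrow> _)"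
proof
  fix a b :: 'a and x y :: "'b \<Rightarrow>\<^sub>0 'a"
  have lookup: "Poly_Mapping.lookup (Poly_Mapping.map ((*) c) z) k = c * Poly_Mapping.lookup z k"
    for c :: 'a and z :: "'b \<Rightarrow>\<^sub>0 'a" and k
    by (simp add: Poly_Mapping.map.rep_eq when_def)
  show "Poly_Mapping.map ((*) a) (x + y) = Poly_Mapping.map ((*) a) x + Poly_Mapping.map ((*) a) y"
    "Poly_Mapping.map ((*) (a + b)) x = Poly_Mapping.map ((*) a) x + Poly_Mapping.map ((*) b) x"
    "Poly_Mapping.map ((*) a) (Poly_Mapping.map ((*) b) x) = Poly_Mapping.map ((*) (a * b)) x"
    "Poly_Mapping.map ((*) 1) x = x"
    by (auto intro!: poly_mapping_eqI simp: lookup lookup_add algebra_simps)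
qed

lemma word_eval_diff:
  assumes "module scale"
  shows "word_eval scale \<iota> (P - Q) = word_eval scale \<iota> P - word_eval scale \<iota> Q"
proof -
  interpret module scale
    by fact
  let ?A = "Poly_Mapping.keys P \<union> Poly_Mapping.keys Q"
  have eq: "word_eval scale \<iota> R
      = (\<Sum>xs\<in>?A. scale (Poly_Mapping.lookup R xs) (prod_list (map \<iota> xs)))"
    if "Poly_Mapping.keys R \<subseteq> ?A" for R
    unfolding word_eval_def
    by (rule sum.mono_neutral_left) (use that in \<open>auto simp: in_keys_iff\<close>)
  have "Poly_Mapping.keys (P - Q) \<subseteq> ?A"
    by (auto simp: in_keys_iff lookup_minus)
  then show ?thesis
    by (simp add: eq lookup_minus scale_left_diff_distrib sum_subtractf)
qed

lemma word_eval_single: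
  assumes "module scale"
  shows "word_eval scale \<iota> (Poly_Mapping.single xs c) = scale c (prod_list (map \<iota> xs))"
proof -
  interpret module scale
    by fact
  show ?thesis
    by (simp add: word_eval_def)
qed

text \<open>Evaluation kills the ideal, and the linearity relations with empty words on both sides
  belong to it.\<close>

lemma symmetric_superalgebra_linear:
  assumes sym: "is_symmetric_superalgebra scaleW W scale V \<iota>"
  shows "\<iota> (a + b) = \<iota> a + \<iota> b" "\<iota> (scaleW c a) = scale c (\<iota> a)"
proof -
  interpret comm_superalgebra scale V
    using sym by (simp add: is_symmetric_superalgebra_def)
  have zero: "word_eval scale \<iota> P = 0" if "P \<in> sym_relations scaleW W" for P
  proof -
    have "P \<in> sym_ideal scaleW W"
      unfolding sym_ideal_def using module_poly_mapping that by (rule module.span_base)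
    then show ?thesis
      using sym by (auto simp: is_symmetric_superalgebra_def)
  qed
  have "Poly_Mapping.single ([] @ [a + b] @ []) 1 - Poly_Mapping.single ([] @ [a] @ []) 1
      - Poly_Mapping.single ([] @ [b] @ []) 1 \<in> sym_relations scaleW W"
    unfolding sym_relations_def by blast
  from zero [OF this] show "\<iota> (a + b) = \<iota> a + \<iota> b"
    unfolding word_eval_diff [OF module_axioms] word_eval_single [OF module_axioms]
    by (simp add: algebra_simps)
  have "Poly_Mapping.single ([] @ [scaleW c a] @ []) 1 - Poly_Mapping.single ([] @ [a] @ []) c
      \<in> sym_relations scaleW W"
    unfolding sym_relations_def by blast
  from zero [OF this] show "\<iota> (scaleW c a) = scale c (\<iota> a)"
    by (simp add: word_eval_diff word_eval_single module_axioms)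
qed

text \<open>The point is that words in the derivatives of basis images span V. By induction on the
  polynomial w, the image of w is a combination of such derivatives; products of combinations expand
  into words, and evaluation of words is surjective.\<close>

lemma free_superfermion_pva_superfermion:
  fixes scaleH :: "'f::field_char_0 \<Rightarrow> 'h::ab_group_add \<Rightarrow> 'h"
    and scale :: "'f \<Rightarrow> 'v::ring_1 \<Rightarrow> 'v"
  assumes "skew_superspace scaleH H form"
    and free: "free_superfermion_pva scaleH H form scale V der br \<iota>"
  obtains B :: "'h set" and gen dual par gram where "superfermion scale V der br B gen dual par gram"
proof -
  interpret H: skew_superspace scaleH H form
    by fact
  interpret pva scale V der br
    using free by (simp add: free_superfermion_pva_def)
  have sym: "is_symmetric_superalgebra (\<lambda>c. map_poly (scaleH c)) (\<lambda>i. {w. \<forall>n. coeff w n \<in> H i})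
      scale V \<iota>"
    and der_\<iota>: "\<And>w. der (\<iota> w) = \<iota> (pCons 0 w)"
    and br_\<iota>: "\<And>a b. br (\<iota> [:a:]) (\<iota> [:b:]) = [:scale (form a b) 1:]"
    using free by (simp_all add: free_superfermion_pva_def)
  note \<iota>_add = symmetric_superalgebra_linear(1) [OF sym]
    and \<iota>_scale = symmetric_superalgebra_linear(2) [OF sym]
  have add\<iota>: "additive \<iota>"
    by (simp add: additive_def \<iota>_add)
  obtain B par dual where B: "finite B" "H.span B = UNIV" "\<And>e. e \<in> B \<Longrightarrow> e \<in> H (par e)"
    "\<And>e. e \<in> B \<Longrightarrow> dual e \<in> H (par e)"
    "\<And>e e'. e \<in> B \<Longrightarrow> e' \<in> B \<Longrightarrow> form (dual e) e' = (if e = e' then 1 else 0)"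
    "\<And>a. a = (\<Sum>e\<in>B. scaleH (form a e) (dual e))"
    by (rule H.homogeneous_dual_bases) blast
  define g where "g a = \<iota> [:a:]" for a
  have add_g: "additive g"
    by (rule additive.intro) (simp add: g_def \<iota>_add [symmetric])
  have g_scale: "g (scaleH c a) = scale c (g a)" for c a
    by (simp add: g_def \<iota>_scale [symmetric] map_poly_pCons)
  have g_par: "g a \<in> V i" if "a \<in> H i" for a i
  proof -
    have "[:a:] \<in> {w. \<forall>n. coeff w n \<in> H i}"
      using that H.V_zero by (auto simp: coeff_pCons split: nat.splits)
    then show ?thesis
      using sym by (auto simp: is_symmetric_superalgebra_def g_def)
  qed
  let ?W = "{prod_list (map (\<lambda>(e, n). (der ^^ n) (g e)) w) | w. fst ` set w \<subseteq> B}"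
  let ?L = "{(der ^^ n) (g e) | n e. e \<in> B}"
  have der_L: "der x \<in> span ?L" if "x \<in> span ?L" for x
    using that
  proof (induction rule: span_induct_alt)
    case base
    then show ?case
      by (simp add: additive.zero [OF additive_der] span_zero)
  next
    case (step c x y)
    obtain n e where "x = (der ^^ n) (g e)" "e \<in> B"
      using step.hyps by blast
    then have "der x = (der ^^ Suc n) (g e) \<and> e \<in> B"
      by simp
    then have "der x \<in> ?L"
      by blast
    then show ?case
      using step.IH by (simp add: additive.add [OF additive_der] leibniz_map_scale [OF leibniz_map_der]
          span_add span_scale span_base)
  qed
  have g_L: "g a \<in> span ?L" for a
  proof -
    have "a \<in> H.span B"
      by (simp add: B)
    then show ?thesis
    proof (induction rule: H.span_induct_alt)
      case base
      then show ?case
        by (simp add: additive.zero [OF add_g] span_zero)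
    next
      case (step c x y)
      have "(der ^^ 0) (g x) \<in> ?L"
        using step.hyps by blast
      then show ?case
        using step.IH by (simp add: additive.add [OF add_g] g_scale span_add span_scale span_base)
    qed
  qed
  have \<iota>_L: "\<iota> w \<in> span ?L" for w
  proof (induction w)
    case 0
    then show ?case
      by (simp add: additive.zero [OF add\<iota>] span_zero)
  next
    case (pCons a w)
    have "\<iota> (pCons a w) = g a + der (\<iota> w)"
      by (simp add: g_def der_\<iota> \<iota>_add [symmetric])
    then show ?case
      using pCons g_L der_L by (simp add: span_add)
  qed
  have L_mult: "x * y \<in> span ?W" if x: "x \<in> span ?L" and y: "y \<in> span ?W" for x y
    using x
  proof (induction rule: span_induct_alt)
    case base
    then show ?case
      by (simp add: span_zero)
  next
    case (step c x z)
    obtain n e where x: "x = (der ^^ n) (g e)" "e \<in> B"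
      using step.hyps by blast
    have "x * y \<in> span ?W"
      using y
    proof (induction rule: span_induct_alt)
      case base
      then show ?case
        by (simp add: span_zero)
    next
      case (step b u v)
      obtain w where w: "u = prod_list (map (\<lambda>(e, n). (der ^^ n) (g e)) w)" "fst ` set w \<subseteq> B"
        using step.hyps by blast
      have "x * u = prod_list (map (\<lambda>(e, n). (der ^^ n) (g e)) ((e, n) # w)) \<and> fst ` set ((e, n) # w) \<subseteq> B"
        using w x by simp
      then have "x * u \<in> ?W"
        by blast
      then show ?case
        using step.IH by (simp add: distrib_left scale_mult_right span_add span_scale span_base)
    qed
    then show ?case
      using step.IH by (simp add: distrib_right scale_mult_left span_add span_scale)
  qed
  have word: "prod_list (map \<iota> xs) \<in> span ?W" for xs
  proof (induction xs)
    case Nil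
    have "prod_list (map (\<lambda>(e, n). (der ^^ n) (g e)) []) \<in> ?W"
      by (intro CollectI exI [of _ "[]"]) simp
    then show ?case
      by (simp add: span_base)
  next
    case (Cons w xs)
    then show ?case
      using L_mult [OF \<iota>_L] by simp
  qed
  have span_W: "span ?W = UNIV"
  proof -
    have "x \<in> span ?W" for x
    proof -
      obtain P where "x = word_eval scale \<iota> P"
        using sym unfolding is_symmetric_superalgebra_def surj_def by blast
      then show ?thesis
        unfolding word_eval_def by (simp add: span_sum span_scale word)
    qed
    then show ?thesis
      by blast
  qed
  have g_dual: "g e = (\<Sum>e'\<in>B. scale (form e e') (g (dual e')))" for e
    by (subst B(6) [of e]) (simp only: additive.sum [OF add_g] g_scale)
  have br_g: "br (g (dual e)) (g e') = [:if e = e' then 1 else 0:]" if "e \<in> B" "e' \<in> B" for e e'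
    using that by (simp add: g_def br_\<iota> B(5))
  have "superfermion scale V der br B g (\<lambda>e. g (dual e)) par form"
  proof unfold_locales
    show "finite B"
      by (rule B)
    show "g e \<in> V (par e)" "g (dual e) \<in> V (par e)" if "e \<in> B" for e
      using B that by (simp_all add: g_par)
    show "form e e' = 0" if "e \<in> B" "e' \<in> B" "par e \<noteq> par e'" for e e'
      using H.form_even B that by blast
    show "br (g (dual e)) (g e') = [:if e = e' then 1 else 0:]" if "e \<in> B" "e' \<in> B" for e e'
      using that by (rule br_g)
    show "g e = (\<Sum>e'\<in>B. scale (form e e') (g (dual e')))" for e
      by (rule g_dual)
    show "span ?W = UNIV"
      by (rule span_W)
  qed
  then show thesis
    by (rule that)
qed


theorem corollary4p8:
  fixes scaleH :: "'f::field_char_0 \<Rightarrow> 'h::ab_group_add \<Rightarrow> 'h"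
    and H :: "bit \<Rightarrow> 'h set"
    and form :: "'h \<Rightarrow> 'h \<Rightarrow> 'f"
    and scale :: "'f \<Rightarrow> 'v::ring_1 \<Rightarrow> 'v"
    and V :: "bit \<Rightarrow> 'v set"
    and der :: "'v \<Rightarrow> 'v"
    and br :: "'v \<Rightarrow> 'v \<Rightarrow> 'v poly"
    and \<iota> :: "'h poly \<Rightarrow> 'v"
  assumes "skew_superspace scaleH H form"
    and "free_superfermion_pva scaleH H form scale V der br \<iota>"
  shows "(\<forall>C \<in> casimir_elements der br. \<exists>c. C = loc_fun der (scale c 1)) \<and>
         (\<forall>D. pva_derivation scale V der br D \<longrightarrow> inner_derivation br D) \<and>
         (\<forall>cbr. first_order_deformation scale V der br cbr \<longrightarrow>
            trivial_deformation scale V der br cbr)"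
proof -
  obtain B :: "'h set" and gen dual par gram where "superfermion scale V der br B gen dual par gram"
    using free_superfermion_pva_superfermion [OF assms] .
  then interpret superfermion scale V der br B gen dual par gram .
  have "\<exists>c. C = loc_fun der (scale c 1)" if C_in: "C \<in> casimir_elements der br" for C
  proof -
    obtain a where C: "C = loc_fun der a" and a: "\<And>b. coeff (br a b) 0 = 0"
      using C_in unfolding casimir_elements_def by blast
    obtain c y where y: "a = scale c 1 + der y"
      using casimir_trivial [OF a] by blast
    have "a + der b = scale c 1 + der (y + b)" "scale c 1 + der b = a + der (b - y)" for b
      by (simp_all add: y additive.add [OF additive_der] additive.diff [OF additive_der])
    then have "C = loc_fun der (scale c 1)"
      unfolding C loc_fun_def by blast
    then show ?thesis ..
  qed
  moreover have "inner_derivation br D" if D_in: "pva_derivation scale V der br D" for D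
  proof -
    obtain D0 D1 where D: "homogeneous_pva_derivation scale V der br 0 D0"
      "homogeneous_pva_derivation scale V der br 1 D1" "D = (\<lambda>x. D0 x + D1 x)"
      using D_in unfolding pva_derivation_def by blast
    obtain a0 a1 where "\<And>x. D0 x = coeff (br a0 x) 0" "\<And>x. D1 x = coeff (br a1 x) 0"
      using homogeneous_derivation_inner [OF D(1)] homogeneous_derivation_inner [OF D(2)] by blast
    then have "D = (\<lambda>x. coeff (br (a0 + a1) x) 0)"
      by (simp add: D(3) additive.add [OF additive_br_left])
    then show ?thesis
      unfolding inner_derivation_def ..
  qed
  moreover have "trivial_deformation scale V der br cbr"
    if "first_order_deformation scale V der br cbr" for cbr
  proof -
    interpret pva_cocycle scale V der br cbr
      using that by (rule first_order_deformation_cocycle)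
    interpret superfermion_cocycle scale V der br B gen dual par gram cbr ..
    show ?thesis
      by (rule deformation_trivial)
  qed
  ultimately show ?thesis
    by blast
qed

end
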